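(* Let $M$ be a type number two hypersurface in a semi-Riemannian space of constant curvature $N_{s}^{n+1}(c)$, $n \geq 4$, i.e. a connected hypersurface isometrically immersed in $N_s^{n+1}(c)$ whose second fundamental tensor $H$ satisfies $\mathrm{rank}(H)=2$ at every point of $M$. Then on $\mathcal{U}_{S}\cap\mathcal{U}_{C} \subset M$ the following condition is satisfied: $$C\cdot R - R\cdot C = Q(S,C) + L_{1}\,Q(g,C) - \frac{1}{(n-2)^{2}}\,Q\Big(g,\; g\wedge S^{2} + \frac{n-2}{2}\,S\wedge S - \kappa\, g\wedge S\Big),$$ where $L_{1}$ is some function on this set. Moreover, if $M$ is a quasi-Einstein hypersurface satisfying $\mathrm{rank}(S-\alpha\, g) = 1$ on $\mathcal{U}_{S}\cap\mathcal{U}_{C}$, for some function $\alpha$, then on this set $$C\cdot R - R\cdot C = Q(S,C) + L_{1}\,Q(g,C).$$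
   Context: All manifolds are connected, paracompact and of class $C^{\infty}$. $N_s^{n+1}(c)$ is a semi-Riemannian space of constant curvature $c$ with signature $(s,n+1-s)$. $g$ is the (non-degenerate) metric induced on the hypersurface $M$, $\dim M=n$, and $H$ is its second fundamental tensor, a symmetric $(0,2)$-tensor. For $(M,g)$ with Levi-Civita connection $\nabla$ put $\mathcal{R}(X,Y)Z = \nabla_X\nabla_Y Z - \nabla_Y\nabla_X Z - \nabla_{[X,Y]}Z$. The Ricci tensor is $S(X,Y) = \mathrm{tr}\{Z \mapsto \mathcal{R}(Z,X)Y\}$, the Ricci operator $\mathcal{S}$ is given by $g(\mathcal{S}X,Y) = S(X,Y)$, $\kappa = \mathrm{tr}\,\mathcal{S}$ is the scalar curvature, and $S^{2}(X,Y) = S(\mathcal{S}X,Y)$. For a symmetric $(0,2)$-tensor $A$ define $(X\wedge_A Y)Z = A(Y,Z)X - A(X,Z)Y$. The Weyl endomorphism is $$\mathcal{C}(X,Y)Z = \mathcal{R}(X,Y)Z - \frac{1}{n-2}\Big(X\wedge_g \mathcal{S}Y + \mathcal{S}X\wedge_g Y - \frac{\kappa}{n-1}X\wedge_g Y\Big)Z.$$ The $(0,4)$-tensors $R$ and $C$ are $R(X_1,X_2,X_3,X_4) = g(\mathcal{R}(X_1,X_2)X_3,X_4)$ and $C(X_1,X_2,X_3,X_4) = g(\mathcal{C}(X_1,X_2)X_3,X_4)$. For $B\in\{R,C\}$ with corresponding endomorphism $\mathcal{B}\in\{\mathcal{R},\mathcal{C}\}$, a $(0,4)$-tensor $T$ and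 a symmetric $(0,2)$-tensor $A$, the $(0,6)$-tensors $B\cdot T$ and $Q(A,T)$ are $$(B\cdot T)(X_1,\ldots,X_4,X,Y) = -T(\mathcal{B}(X,Y)X_1,X_2,X_3,X_4) - \cdots - T(X_1,X_2,X_3,\mathcal{B}(X,Y)X_4),$$ $$Q(A,T)(X_1,\ldots,X_4,X,Y) = -T((X\wedge_A Y)X_1,X_2,X_3,X_4) - \cdots - T(X_1,X_2,X_3,(X\wedge_A Y)X_4).$$ The Kulkarni-Nomizu product of symmetric $(0,2)$-tensors $E,F$ is $$(E\wedge F)(X_1,X_2,X_3,X_4) = E(X_1,X_4)F(X_2,X_3) + E(X_2,X_3)F(X_1,X_4) - E(X_1,X_3)F(X_2,X_4) - E(X_2,X_4)F(X_1,X_3).$$ $\mathcal{U}_S$ is the set of points of $M$ at which $S\neq\frac{\kappa}{n}g$, and $\mathcal{U}_C$ is the set of points of $M$ at which $C\neq 0$. *)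

theory Defs
  imports "HOL-Analysis.Analysis"
begin

section \<open>Smooth manifolds\<close>

text \<open>
  \<open>Ck_on k f U\<close> is meant for open \<open>U\<close>: \<open>f\<close> is of class \<open>C^k\<close> iff all its directional
  derivatives are of class \<open>C^(k-1)\<close>.
\<close>

primrec Ck_on :: "nat \<Rightarrow> ('a::real_normed_vector \<Rightarrow> 'b::real_normed_vector) \<Rightarrow> 'a set \<Rightarrow> bool" where
  "Ck_on 0 f U \<longleftrightarrow> continuous_on U f"
| "Ck_on (Suc k) f U \<longleftrightarrow>
     (\<forall>x\<in>U. f differentiable (at x)) \<and> (\<forall>v. Ck_on k (\<lambda>x. frechet_derivative f (at x) v) U)"

definition smooth_on :: "('a::real_normed_vector \<Rightarrow> 'b::real_normed_vector) \<Rightarrow> 'a set \<Rightarrow> bool" where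
  "smooth_on f U \<longleftrightarrow> (\<forall>k. Ck_on k f U)"

text \<open>A chart is a pair of a domain and a coordinate map on it.\<close>

type_synonym ('p, 'a) chart = "'p set \<times> ('p \<Rightarrow> 'a)"

definition charts_at :: "('p, 'a) chart set \<Rightarrow> 'p \<Rightarrow> ('p, 'a) chart set" where
  "charts_at \<A> p = {c \<in> \<A>. p \<in> fst c}"

text \<open>
  The expression of a map \<open>f\<close> in charts \<open>c\<close> of the source and \<open>d\<close> of the target, and the set on
  which it is defined. For \<open>f = id\<close> this is the transition map from \<open>c\<close> to \<open>d\<close>.
\<close>

definition coord_dom :: "('p \<Rightarrow> 'q) \<Rightarrow> ('p, 'a) chart \<Rightarrow> ('q, 'b) chart \<Rightarrow> 'a set" where
  "coord_dom f c d = snd c ` (fst c \<inter> f -` fst d)"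

definition coord_map :: "('p \<Rightarrow> 'q) \<Rightarrow> ('p, 'a) chart \<Rightarrow> ('q, 'b) chart \<Rightarrow> 'a \<Rightarrow> 'b" where
  "coord_map f c d = snd d \<circ> f \<circ> inv_into (fst c) (snd c)"

definition smooth_atlas :: "'p topology \<Rightarrow> ('p, 'a::euclidean_space) chart set \<Rightarrow> bool" where
  "smooth_atlas X \<A> \<longleftrightarrow>
     (\<forall>c\<in>\<A>. openin X (fst c) \<and> open (snd c ` fst c) \<and>
        homeomorphic_map (subtopology X (fst c)) (top_of_set (snd c ` fst c)) (snd c)) \<and>
     (\<Union>c\<in>\<A>. fst c) = topspace X \<and>
     (\<forall>c\<in>\<A>. \<forall>d\<in>\<A>. smooth_on (coord_map id c d) (coord_dom id c d))"

definition paracompact_top :: "'p topology \<Rightarrow> bool" where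
  "paracompact_top X \<longleftrightarrow>
     (\<forall>\<U>. (\<forall>U\<in>\<U>. openin X U) \<and> \<Union>\<U> = topspace X \<longrightarrow>
        (\<exists>\<V>. (\<forall>V\<in>\<V>. openin X V \<and> (\<exists>U\<in>\<U>. V \<subseteq> U)) \<and> \<Union>\<V> = topspace X \<and>
             locally_finite_in X \<V>))"

definition manifold :: "'p topology \<Rightarrow> ('p, 'a::euclidean_space) chart set \<Rightarrow> bool" where
  "manifold X \<A> \<longleftrightarrow>
     Hausdorff_space X \<and> connected_space X \<and> paracompact_top X \<and> smooth_atlas X \<A>"

section \<open>Semi-Riemannian metrics and isometric immersions\<close>

text \<open>
  A \<open>(0,2)\<close>-tensor field \<open>g\<close> is given by its components in every chart: \<open>g c x u v\<close> is the value
  at the point with coordinates \<open>x\<close> in the chart \<open>c\<close> on the tangent vectors whose coordinates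
  in \<open>c\<close> are \<open>u\<close> and \<open>v\<close>. The relation \<open>pulls_back f \<A> g \<B> h\<close> says that \<open>g\<close> is the pullback
  of \<open>h\<close> along \<open>f\<close>; with \<open>f = id\<close> it is the transformation law of a \<open>(0,2)\<close>-tensor.
\<close>

type_synonym 'a bilin = "'a \<Rightarrow> 'a \<Rightarrow> real"
type_synonym 'a tensor4 = "'a \<Rightarrow> 'a \<Rightarrow> 'a \<Rightarrow> 'a \<Rightarrow> real"
type_synonym 'a tensor6 = "'a \<Rightarrow> 'a \<Rightarrow> 'a \<Rightarrow> 'a \<Rightarrow> 'a \<Rightarrow> 'a \<Rightarrow> real"
type_synonym 'a endo = "'a \<Rightarrow> 'a \<Rightarrow> 'a \<Rightarrow> 'a"
type_synonym ('p, 'a) tensor2_field = "('p, 'a) chart \<Rightarrow> 'a \<Rightarrow> 'a bilin"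

definition pulls_back ::
  "('p \<Rightarrow> 'q) \<Rightarrow> ('p, 'a::euclidean_space) chart set \<Rightarrow> ('p, 'a) tensor2_field \<Rightarrow>
   ('q, 'b::euclidean_space) chart set \<Rightarrow> ('q, 'b) tensor2_field \<Rightarrow> bool" where
  "pulls_back f \<A> g \<B> h \<longleftrightarrow>
     (\<forall>c\<in>\<A>. \<forall>d\<in>\<B>. \<forall>x\<in>coord_dom f c d. \<forall>u v.
        g c x u v =
        h d (coord_map f c d x)
          (frechet_derivative (coord_map f c d) (at x) u)
          (frechet_derivative (coord_map f c d) (at x) v))"

definition metric_at :: "'a::real_normed_vector bilin \<Rightarrow> bool" where
  "metric_at b \<longleftrightarrow>
     bilinear b \<and> (\<forall>u v. b u v = b v u) \<and> (\<forall>u. (\<forall>v. b u v = 0) \<longrightarrow> u = 0)"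

definition semi_riemannian_metric ::
  "('p, 'a::euclidean_space) chart set \<Rightarrow> ('p, 'a) tensor2_field \<Rightarrow> bool" where
  "semi_riemannian_metric \<A> g \<longleftrightarrow>
     (\<forall>c\<in>\<A>. (\<forall>x\<in>snd c ` fst c. metric_at (g c x)) \<and>
              (\<forall>u v. smooth_on (\<lambda>x. g c x u v) (snd c ` fst c))) \<and>
     pulls_back id \<A> g \<A> g"

text \<open>
  The index of a bilinear form is the largest dimension of a subspace on which it is negative
  definite. Signature \<open>(s, m - s)\<close> in dimension \<open>m\<close> is read as index \<open>s\<close>.
\<close>

definition has_index :: "'a::euclidean_space bilin \<Rightarrow> nat \<Rightarrow> bool" where
  "has_index b s \<longleftrightarrow>
     (\<exists>W. subspace W \<and> (\<forall>w\<in>W - {0}. b w w < 0) \<and> dim W = s) \<and>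
     (\<forall>W. subspace W \<and> (\<forall>w\<in>W - {0}. b w w < 0) \<longrightarrow> dim W \<le> s)"

definition metric_index ::
  "('p, 'a::euclidean_space) chart set \<Rightarrow> ('p, 'a) tensor2_field \<Rightarrow> nat \<Rightarrow> bool" where
  "metric_index \<A> g s \<longleftrightarrow> (\<forall>c\<in>\<A>. \<forall>x\<in>snd c ` fst c. has_index (g c x) s)"

definition isometric_immersion ::
  "'p topology \<Rightarrow> ('p, 'a::euclidean_space) chart set \<Rightarrow> ('p, 'a) tensor2_field \<Rightarrow>
   'q topology \<Rightarrow> ('q, 'b::euclidean_space) chart set \<Rightarrow> ('q, 'b) tensor2_field \<Rightarrow>
   ('p \<Rightarrow> 'q) \<Rightarrow> bool" where
  "isometric_immersion X \<A> g Y \<B> h f \<longleftrightarrow>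
     continuous_map X Y f \<and>
     (\<forall>c\<in>\<A>. \<forall>d\<in>\<B>. smooth_on (coord_map f c d) (coord_dom f c d) \<and>
        (\<forall>x\<in>coord_dom f c d. inj (frechet_derivative (coord_map f c d) (at x)))) \<and>
     pulls_back f \<A> g \<B> h"

section \<open>Levi-Civita connection and curvature in a chart\<close>

text \<open>
  In this section \<open>G\<close> is the coordinate expression of the metric in one chart, and vector fields
  on the chart are maps from coordinates to coordinate vectors. The Levi-Civita connection is
  \<open>(\<nabla>_X Y)(x) = DY(x)(X(x)) + \<Gamma>_x(X(x), Y(x))\<close>, where \<open>\<Gamma>_x\<close> is determined by vanishing
  torsion (symmetry) and \<open>\<nabla>g = 0\<close>.
\<close>

definition christoffel :: "('a::euclidean_space \<Rightarrow> 'a bilin) \<Rightarrow> 'a \<Rightarrow> 'a \<Rightarrow> 'a \<Rightarrow> 'a" where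
  "christoffel G x = (THE \<Gamma>. bilinear \<Gamma> \<and> (\<forall>u v. \<Gamma> u v = \<Gamma> v u) \<and>
     (\<forall>u v w. frechet_derivative (\<lambda>y. G y v w) (at x) u = G x (\<Gamma> u v) w + G x v (\<Gamma> u w)))"

definition cov_deriv ::
  "('a::euclidean_space \<Rightarrow> 'a bilin) \<Rightarrow> ('a \<Rightarrow> 'a) \<Rightarrow> ('a \<Rightarrow> 'a) \<Rightarrow> 'a \<Rightarrow> 'a" where
  "cov_deriv G X Y x = frechet_derivative Y (at x) (X x) + christoffel G x (X x) (Y x)"

definition lie_bracket :: "('a::euclidean_space \<Rightarrow> 'a) \<Rightarrow> ('a \<Rightarrow> 'a) \<Rightarrow> 'a \<Rightarrow> 'a" where
  "lie_bracket X Y x = frechet_derivative Y (at x) (X x) - frechet_derivative X (at x) (Y x)"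

definition curvature_fields ::
  "('a::euclidean_space \<Rightarrow> 'a bilin) \<Rightarrow> ('a \<Rightarrow> 'a) \<Rightarrow> ('a \<Rightarrow> 'a) \<Rightarrow> ('a \<Rightarrow> 'a) \<Rightarrow> 'a \<Rightarrow> 'a" where
  "curvature_fields G X Y Z x =
     cov_deriv G X (cov_deriv G Y Z) x - cov_deriv G Y (cov_deriv G X Z) x
     - cov_deriv G (lie_bracket X Y) Z x"

text \<open>
  The curvature is tensorial, so its value on tangent vectors is computed by extending them to
  vector fields with constant coordinates.
\<close>

definition curv :: "('a::euclidean_space \<Rightarrow> 'a bilin) \<Rightarrow> 'a \<Rightarrow> 'a endo" where
  "curv G x u v w = curvature_fields G (\<lambda>_. u) (\<lambda>_. v) (\<lambda>_. w) x"

definition lower :: "'a bilin \<Rightarrow> 'a endo \<Rightarrow> 'a tensor4" where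
  "lower b B X1 X2 X3 X4 = b (B X1 X2 X3) X4"

definition riem :: "('a::euclidean_space \<Rightarrow> 'a bilin) \<Rightarrow> 'a \<Rightarrow> 'a tensor4" where
  "riem G x = lower (G x) (curv G x)"

text \<open>Constant sectional curvature \<open>k\<close>: the condition runs over all non-degenerate tangent planes.\<close>

definition constant_curvature ::
  "('p, 'a::euclidean_space) chart set \<Rightarrow> ('p, 'a) tensor2_field \<Rightarrow> real \<Rightarrow> bool" where
  "constant_curvature \<A> g k \<longleftrightarrow>
     (\<forall>c\<in>\<A>. \<forall>x\<in>snd c ` fst c. \<forall>u v.
        g c x u u * g c x v v - (g c x u v)\<^sup>2 \<noteq> 0 \<longrightarrow>
        riem (g c) x u v v u / (g c x u u * g c x v v - (g c x u v)\<^sup>2) = k)"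

definition wedge :: "'a::real_vector bilin \<Rightarrow> 'a endo" where
  "wedge A X Y Z = A Y Z *\<^sub>R X - A X Z *\<^sub>R Y"

definition ricci :: "(real^'n \<Rightarrow> (real^'n) bilin) \<Rightarrow> real^'n \<Rightarrow> (real^'n) bilin" where
  "ricci G x X Y = trace (matrix (\<lambda>Z. curv G x Z X Y))"

definition ricci_op :: "(real^'n \<Rightarrow> (real^'n) bilin) \<Rightarrow> real^'n \<Rightarrow> real^'n \<Rightarrow> real^'n" where
  "ricci_op G x X = (THE W. \<forall>Y. G x W Y = ricci G x X Y)"

definition scalar_curv :: "(real^'n \<Rightarrow> (real^'n) bilin) \<Rightarrow> real^'n \<Rightarrow> real" where
  "scalar_curv G x = trace (matrix (ricci_op G x))"

definition ricci_sq :: "(real^'n \<Rightarrow> (real^'n) bilin) \<Rightarrow> real^'n \<Rightarrow> (real^'n) bilin" where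
  "ricci_sq G x X Y = ricci G x (ricci_op G x X) Y"

definition weyl_endo :: "(real^'n \<Rightarrow> (real^'n) bilin) \<Rightarrow> real^'n \<Rightarrow> (real^'n) endo" where
  "weyl_endo G x X Y Z =
     curv G x X Y Z
     - (1 / (real CARD('n) - 2)) *\<^sub>R
         (wedge (G x) X (ricci_op G x Y) Z + wedge (G x) (ricci_op G x X) Y Z
          - (scalar_curv G x / (real CARD('n) - 1)) *\<^sub>R wedge (G x) X Y Z)"

definition weyl :: "(real^'n \<Rightarrow> (real^'n) bilin) \<Rightarrow> real^'n \<Rightarrow> (real^'n) tensor4" where
  "weyl G x = lower (G x) (weyl_endo G x)"

section \<open>Algebraic operations on tensors at a point\<close>

definition dot :: "'a endo \<Rightarrow> 'a tensor4 \<Rightarrow> 'a tensor6" where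
  "dot B T X1 X2 X3 X4 X Y =
     - T (B X Y X1) X2 X3 X4 - T X1 (B X Y X2) X3 X4
     - T X1 X2 (B X Y X3) X4 - T X1 X2 X3 (B X Y X4)"

definition Q :: "'a::real_vector bilin \<Rightarrow> 'a tensor4 \<Rightarrow> 'a tensor6" where
  "Q A T = dot (wedge A) T"

definition kulkarni_nomizu :: "'a bilin \<Rightarrow> 'a bilin \<Rightarrow> 'a tensor4" where
  "kulkarni_nomizu E F X1 X2 X3 X4 =
     E X1 X4 * F X2 X3 + E X2 X3 * F X1 X4 - E X1 X3 * F X2 X4 - E X2 X4 * F X1 X3"

definition bilin_rank :: "(real^'n) bilin \<Rightarrow> nat" where
  "bilin_rank b = rank (\<chi> i j. b (axis i 1) (axis j 1))"

section \<open>Second fundamental tensor\<close>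

text \<open>
  \<open>h\<close> is the ambient metric in a chart and \<open>F\<close> the immersion in charts. A unit normal satisfies
  \<open>h(\<xi>,\<xi>) = \<epsilon>\<close> with \<open>\<epsilon> = 1\<close> or \<open>\<epsilon> = -1\<close>; pairing the Gauss formula
  \<open>\<nabla>'_X F_*Y = F_*(\<nabla>_X Y) + \<epsilon> H(X,Y) \<xi>\<close> with \<open>\<xi>\<close> gives \<open>H(X,Y) = h(\<nabla>'_X F_*Y, \<xi>)\<close>, where
  \<open>\<nabla>'\<close> is the ambient connection, here applied to fields with constant coordinates.
\<close>

definition unit_normal ::
  "('b::euclidean_space \<Rightarrow> 'b bilin) \<Rightarrow> ('a::euclidean_space \<Rightarrow> 'b) \<Rightarrow> 'a \<Rightarrow> 'b \<Rightarrow> bool" where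
  "unit_normal h F x \<xi> \<longleftrightarrow>
     \<bar>h (F x) \<xi> \<xi>\<bar> = 1 \<and> (\<forall>u. h (F x) (frechet_derivative F (at x) u) \<xi> = 0)"

definition second_fund ::
  "('b::euclidean_space \<Rightarrow> 'b bilin) \<Rightarrow> ('a::euclidean_space \<Rightarrow> 'b) \<Rightarrow> 'b \<Rightarrow> 'a \<Rightarrow> 'a bilin" where
  "second_fund h F \<xi> x u v =
     h (F x)
       (frechet_derivative (\<lambda>y. frechet_derivative F (at y) v) (at x) u
        + christoffel h (F x) (frechet_derivative F (at x) u) (frechet_derivative F (at x) v))
       \<xi>"

text \<open>
  The unit normal at a point is unique up to sign, which does not affect the rank of \<open>H\<close>.
\<close>

definition type_number_two ::
  "'p topology \<Rightarrow> ('p, real^'n) chart set \<Rightarrow>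
   ('q, 'b::euclidean_space) chart set \<Rightarrow> ('q, 'b) tensor2_field \<Rightarrow> ('p \<Rightarrow> 'q) \<Rightarrow> bool" where
  "type_number_two X \<A> \<B> h f \<longleftrightarrow>
     (\<forall>p\<in>topspace X. \<forall>c\<in>charts_at \<A> p. \<forall>d\<in>charts_at \<B> (f p).
        \<exists>\<xi>. unit_normal (h d) (coord_map f c d) (snd c p) \<xi> \<and>
            bilin_rank (second_fund (h d) (coord_map f c d) \<xi> (snd c p)) = 2)"

section \<open>The sets of points where the Ricci and the Weyl tensor are non-trivial\<close>

definition U_S :: "'p topology \<Rightarrow> ('p, real^'n) chart set \<Rightarrow> ('p, real^'n) tensor2_field \<Rightarrow> 'p set" where
  "U_S X \<A> g = {p \<in> topspace X. \<exists>c\<in>charts_at \<A> p. \<exists>u v.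
     ricci (g c) (snd c p) u v
       \<noteq> scalar_curv (g c) (snd c p) / real CARD('n) * g c (snd c p) u v}"

definition U_C :: "'p topology \<Rightarrow> ('p, real^'n) chart set \<Rightarrow> ('p, real^'n) tensor2_field \<Rightarrow> 'p set" where
  "U_C X \<A> g = {p \<in> topspace X. \<exists>c\<in>charts_at \<A> p. \<exists>u1 u2 u3 u4.
     weyl (g c) (snd c p) u1 u2 u3 u4 \<noteq> 0}"

end

theory Submission
  imports Defs
begin

text \<open>
  A form \<open>H\<close> of rank two satisfies \<open>H \<and> H = const (\<omega> \<otimes> \<omega>)\<close> for a decomposable 2-form \<open>\<omega>\<close>, so the
  Gauss equation reads \<open>R = k G + lam (\<omega> \<otimes> \<omega>)\<close> with \<open>G = (g \<and> g) / 2\<close>. Let \<open>J\<close> be the skew operator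
  of \<open>\<omega>\<close> and \<open>D\<close> the form of \<open>lam J\<^sup>2\<close>. Then \<open>S = (n - 1) k g + D\<close>, and \<open>J\<^sup>3\<close> is a multiple of \<open>J\<close>,
  whence \<open>D\<^sup>2 = \<tau> D\<close> and \<open>\<kappa> = n (n - 1) k + 2 \<tau>\<close>. As \<open>J\<close> annihilates \<open>g\<close>, \<open>\<omega>\<close> and \<open>D\<close> as a derivation,
  \<open>R \<cdot> C = k Q(g, C)\<close>, while \<open>C \<cdot> R\<close> is a multiple of \<open>Q(g, \<omega> \<otimes> \<omega>)\<close>. Since \<open>Q(D, \<omega> \<otimes> \<omega>) = 0\<close> and
  \<open>Q(A, B \<and> B) = - 2 Q(B, A \<and> B)\<close>, both sides of the claim are combinations of \<open>Q(g, \<omega> \<otimes> \<omega>)\<close>,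
  \<open>Q(g, g \<and> D)\<close> and \<open>Q(g, D \<and> D)\<close>, and \<open>L1\<close> depends only on \<open>\<kappa>\<close>, \<open>k\<close> and \<open>n\<close>. If \<open>S - \<alpha> g\<close> has
  rank one, the tensor in the last term is a multiple of \<open>G\<close>, and \<open>Q(g, G) = 0\<close>.

  The Gauss equation is obtained by differentiating \<open>h(\<nabla>'\<^sub>v F\<^sub>*w, F\<^sub>*z) = g(\<nabla>\<^sub>v w, z)\<close> once more, so that
  no differentiable unit normal field is needed. Applied to a change of charts, it also shows that
  \<open>\<kappa>\<close> does not depend on the chart.
\<close>

section \<open>Symmetry of second derivatives\<close>

lemma smooth_onD:
  assumes "smooth_on f U" "x \<in> U"
  shows "f differentiable (at x)"
proof -
  have "Ck_on (Suc 0) f U" using assms(1) unfolding smooth_on_def by blast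
  then show ?thesis using assms(2) by auto
qed

lemma smooth_on_frechet_derivative:
  assumes "smooth_on f U"
  shows "smooth_on (\<lambda>x. frechet_derivative f (at x) v) U"
proof -
  have "Ck_on (Suc k) f U" for k using assms unfolding smooth_on_def by blast
  then show ?thesis by (auto simp: smooth_on_def)
qed

lemma smooth_on_imp_continuous_on: "smooth_on f U \<Longrightarrow> continuous_on U f"
  unfolding smooth_on_def by (metis Ck_on.simps(1))

lemma has_derivative_frechet:
  assumes "f differentiable (at x)"
  shows "(f has_derivative (\<lambda>u. frechet_derivative f (at x) u)) (at x)"
  using assms by (simp add: frechet_derivative_works)

lemma frechet_eqI: "(f has_derivative f') (at x) \<Longrightarrow> frechet_derivative f (at x) u = f' u"
  using frechet_derivative_at by metis

lemma DERIV_along_line: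
  fixes f :: "'a::real_normed_vector \<Rightarrow> real"
  assumes "f differentiable (at (y + t *\<^sub>R u))"
  shows "((\<lambda>s. f (y + s *\<^sub>R u)) has_real_derivative
           frechet_derivative f (at (y + t *\<^sub>R u)) u) (at t)"
proof -
  have l: "linear (frechet_derivative f (at (y + t *\<^sub>R u)))"
    using assms by (rule linear_frechet_derivative)
  have "((\<lambda>s. f (y + s *\<^sub>R u)) has_derivative
      (\<lambda>s. frechet_derivative f (at (y + t *\<^sub>R u)) (s *\<^sub>R u))) (at t)"
    by (rule has_derivative_compose[of "\<lambda>s. y + s *\<^sub>R u" "\<lambda>s. s *\<^sub>R u" t UNIV f,
          OF _ has_derivative_frechet[OF assms]])
       (auto intro!: derivative_eq_intros)
  then show ?thesis
    by (simp add: has_field_derivative_def linear_scale[OF l] mult.commute[of _ "frechet_derivative _ _ _"])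
qed

text \<open>The mean value theorem is used twice: along \<open>u\<close> for the increment of
  \<open>f\<close> over the \<open>v\<close> step, then along \<open>v\<close> for the derivative of
  \<open>f\<close> in direction \<open>u\<close>.\<close>

lemma second_difference_mvt:
  fixes f :: "'a::real_normed_vector \<Rightarrow> real"
  assumes f: "\<And>y. y \<in> U \<Longrightarrow> f differentiable (at y)"
    and f': "\<And>y. y \<in> U \<Longrightarrow> (\<lambda>z. frechet_derivative f (at z) u) differentiable (at y)"
    and U: "\<And>s t. 0 \<le> s \<Longrightarrow> s \<le> h \<Longrightarrow> 0 \<le> t \<Longrightarrow> t \<le> h \<Longrightarrow> x + s *\<^sub>R u + t *\<^sub>R v \<in> U"
    and h: "0 < h"
  shows "\<exists>s t. 0 < s \<and> s < h \<and> 0 < t \<and> t < h \<and>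
    f (x + h *\<^sub>R u + h *\<^sub>R v) - f (x + h *\<^sub>R u) - f (x + h *\<^sub>R v) + f x =
    h * h * frechet_derivative (\<lambda>z. frechet_derivative f (at z) u) (at (x + s *\<^sub>R u + t *\<^sub>R v)) v"
proof -
  define \<phi> where "\<phi> = (\<lambda>s. f ((x + h *\<^sub>R v) + s *\<^sub>R u) - f (x + s *\<^sub>R u))"
  define \<phi>' where "\<phi>' = (\<lambda>s. frechet_derivative f (at ((x + h *\<^sub>R v) + s *\<^sub>R u)) u
      - frechet_derivative f (at (x + s *\<^sub>R u)) u)"
  have in1: "(x + h *\<^sub>R v) + s *\<^sub>R u \<in> U" if "0 \<le> s" "s \<le> h" for s
    using U[of s h] that h by (simp add: algebra_simps)
  have in2: "x + s *\<^sub>R u \<in> U" if "0 \<le> s" "s \<le> h" for s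
    using U[of s 0] that h by simp
  have "DERIV \<phi> s :> \<phi>' s" if "0 \<le> s" "s \<le> h" for s
    unfolding \<phi>_def \<phi>'_def
    by (intro DERIV_diff DERIV_along_line f in1 in2 that)
  from MVT2[OF h, of \<phi> \<phi>'] this obtain s where s: "0 < s" "s < h" "\<phi> h - \<phi> 0 = (h - 0) * \<phi>' s"
    by auto
  define \<psi> where "\<psi> = (\<lambda>t. frechet_derivative f (at ((x + s *\<^sub>R u) + t *\<^sub>R v)) u)"
  define \<psi>' where "\<psi>' = (\<lambda>t. frechet_derivative (\<lambda>z. frechet_derivative f (at z) u)
      (at ((x + s *\<^sub>R u) + t *\<^sub>R v)) v)"
  have "DERIV \<psi> t :> \<psi>' t" if "0 \<le> t" "t \<le> h" for t
    unfolding \<psi>_def \<psi>'_def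
    using U[of s t] that s by (intro DERIV_along_line f') auto
  from MVT2[OF h, of \<psi> \<psi>'] this obtain t where t: "0 < t" "t < h" "\<psi> h - \<psi> 0 = (h - 0) * \<psi>' t"
    by auto
  have "\<phi>' s = \<psi> h - \<psi> 0" unfolding \<phi>'_def \<psi>_def by (simp add: algebra_simps)
  moreover have "\<phi> h - \<phi> 0 = f (x + h *\<^sub>R u + h *\<^sub>R v) - f (x + h *\<^sub>R u) - f (x + h *\<^sub>R v) + f x"
    unfolding \<phi>_def by (simp add: algebra_simps)
  ultimately show ?thesis using s t unfolding \<psi>'_def by (intro exI[of _ s] exI[of _ t]) simp
qed

text \<open>The second difference is symmetric in \<open>u\<close> and \<open>v\<close>, so the two
  mixed derivatives take equal values at points arbitrarily close to \<open>x\<close>; their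
  continuity carries the equality to \<open>x\<close>.\<close>

lemma second_derivative_symmetric_real:
  fixes f :: "'a::real_normed_vector \<Rightarrow> real"
  assumes f: "smooth_on f U" and U: "open U" "x \<in> U"
  shows "frechet_derivative (\<lambda>z. frechet_derivative f (at z) u) (at x) v =
         frechet_derivative (\<lambda>z. frechet_derivative f (at z) v) (at x) u"
proof -
  define D2 where "D2 = (\<lambda>u v y. frechet_derivative (\<lambda>z. frechet_derivative f (at z) u) (at y) v)"
  have D2s: "smooth_on (D2 u v) U" for u v
    unfolding D2_def by (intro smooth_on_frechet_derivative f)
  have cont: "isCont (D2 u v) x" for u v
    using smooth_on_imp_continuous_on[OF D2s] U by (simp add: continuous_on_eq_continuous_at)
  have "\<bar>D2 u v x - D2 v u x\<bar> < e" if e: "0 < e" for e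
  proof -
    obtain d1 where d1: "d1 > 0" "\<And>y. dist y x < d1 \<Longrightarrow> dist (D2 u v y) (D2 u v x) < e/2"
        using cont[of u v] e by (metis half_gt_zero continuous_at_eps_delta)
    obtain d2 where d2: "d2 > 0" "\<And>y. dist y x < d2 \<Longrightarrow> dist (D2 v u y) (D2 v u x) < e/2"
      using cont[of v u] e by (metis half_gt_zero continuous_at_eps_delta)
    obtain d3 where d3: "d3 > 0" "\<And>y. dist y x < d3 \<Longrightarrow> y \<in> U"
      using U unfolding open_dist by blast
    define d where "d = min d1 (min d2 d3)"
    have d: "d > 0" using d1 d2 d3 by (simp add: d_def)
    \<comment> \<open>This step size keeps all sampled points within d/2 of \<open>x\<close>; the
      summand 1 keeps the denominator positive when \<open>u\<close> and \<open>v\<close> both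
      vanish.\<close>
    define h where "h = d / (2 * (norm u + norm v + 1))"
    have h: "h > 0" using d unfolding h_def by (simp add: add_nonneg_pos)
    \<comment> \<open>The condition on the norms lets one estimate serve both orders of
      \<open>u\<close> and \<open>v\<close>.\<close>
    have near: "dist (x + s *\<^sub>R u' + t *\<^sub>R v') x < d"
      if "0 \<le> s" "s \<le> h" "0 \<le> t" "t \<le> h" and uv: "norm u' + norm v' = norm u + norm v" for s t u' v'
    proof -
      have "dist (x + s *\<^sub>R u' + t *\<^sub>R v') x = norm (s *\<^sub>R u' + t *\<^sub>R v')" by (simp add: dist_norm add.assoc)
      also have "\<dots> \<le> s * norm u' + t * norm v'"
        using that by (intro order_trans[OF norm_triangle_ineq]) simp
      also have "\<dots> \<le> h * norm u' + h * norm v'"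
        using that by (intro add_mono mult_right_mono) auto
      also have "\<dots> = h * (norm u + norm v)" by (simp add: uv[symmetric] algebra_simps)
      also have "\<dots> \<le> h * (norm u + norm v + 1)" using h by simp
      also have "\<dots> = d / 2" unfolding h_def by (simp add: add_nonneg_pos field_simps add_nonneg_eq_0_iff)
      also have "\<dots> < d" using d by simp
      finally show ?thesis .
    qed
    have inU: "x + s *\<^sub>R u + t *\<^sub>R v \<in> U" if "0 \<le> s" "s \<le> h" "0 \<le> t" "t \<le> h" for s t
      using near[of s t u v] that d3(2) by (simp add: d_def)
    have inU': "x + s *\<^sub>R v + t *\<^sub>R u \<in> U" if "0 \<le> s" "s \<le> h" "0 \<le> t" "t \<le> h" for s t
      using near[of s t v u] that d3(2) by (simp add: d_def)
    obtain s t where st: "0 < s" "s < h" "0 < t" "t < h"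
      "f (x + h *\<^sub>R u + h *\<^sub>R v) - f (x + h *\<^sub>R u) - f (x + h *\<^sub>R v) + f x = h * h * D2 u v (x + s *\<^sub>R u + t *\<^sub>R v)"
      using second_difference_mvt[of U f u h x v, OF smooth_onD[OF f]
          smooth_onD[OF smooth_on_frechet_derivative[OF f]] inU h] unfolding D2_def by auto
    obtain s' t' where st': "0 < s'" "s' < h" "0 < t'" "t' < h"
      "f (x + h *\<^sub>R v + h *\<^sub>R u) - f (x + h *\<^sub>R v) - f (x + h *\<^sub>R u) + f x = h * h * D2 v u (x + s' *\<^sub>R v + t' *\<^sub>R u)"
      using second_difference_mvt[of U f v h x u, OF smooth_onD[OF f]
          smooth_onD[OF smooth_on_frechet_derivative[OF f]] inU' h] unfolding D2_def by auto
    have "x + h *\<^sub>R v + h *\<^sub>R u = x + h *\<^sub>R u + h *\<^sub>R v" by simp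
    then have "h * h * D2 u v (x + s *\<^sub>R u + t *\<^sub>R v) = h * h * D2 v u (x + s' *\<^sub>R v + t' *\<^sub>R u)"
      using st(5) st'(5) by (simp only:)
    then have eq: "D2 u v (x + s *\<^sub>R u + t *\<^sub>R v) = D2 v u (x + s' *\<^sub>R v + t' *\<^sub>R u)"
      using h by simp
    have "dist (D2 u v (x + s *\<^sub>R u + t *\<^sub>R v)) (D2 u v x) < e/2"
      using near[of s t u v] st d1 by (simp add: d_def)
    moreover have "dist (D2 v u (x + s' *\<^sub>R v + t' *\<^sub>R u)) (D2 v u x) < e/2"
      using near[of s' t' v u] st' d2 by (simp add: d_def)
    ultimately show ?thesis using eq unfolding dist_real_def by linarith
  qed
  then have "D2 u v x = D2 v u x" by (metis abs_le_zero_iff dense_ge eq_iff_diff_eq_0 less_imp_le)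
  then show ?thesis unfolding D2_def .
qed

lemma frechet_derivative_inner:
  fixes f :: "'a::real_normed_vector \<Rightarrow> 'b::real_inner"
  assumes "f differentiable (at x)"
  shows "frechet_derivative (\<lambda>z. f z \<bullet> b) (at x) u = frechet_derivative f (at x) u \<bullet> b"
    and "(\<lambda>z. f z \<bullet> b) differentiable (at x)"
proof -
  have "((\<lambda>z. f z \<bullet> b) has_derivative (\<lambda>u. frechet_derivative f (at x) u \<bullet> b)) (at x)"
    by (intro has_derivative_inner_left has_derivative_frechet assms)
  then show "frechet_derivative (\<lambda>z. f z \<bullet> b) (at x) u = frechet_derivative f (at x) u \<bullet> b"
    and "(\<lambda>z. f z \<bullet> b) differentiable (at x)"
    by (auto intro: frechet_eqI differentiableI)
qed

lemma frechet_derivative_cong_open: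
  assumes "open U" "x \<in> U" "\<And>y. y \<in> U \<Longrightarrow> f y = g y"
  shows "frechet_derivative f (at x) = frechet_derivative g (at x)"
proof -
  have "(f has_derivative f') (at x) \<longleftrightarrow> (g has_derivative f') (at x)" for f'
    using has_derivative_transform_within_open[of f f' x UNIV U g]
      has_derivative_transform_within_open[of g f' x UNIV U f] assms by metis
  then show ?thesis unfolding frechet_derivative_def by simp
qed

lemma differentiable_cong_open:
  assumes "open U" "x \<in> U" "\<And>y. y \<in> U \<Longrightarrow> f y = g y" "g differentiable (at x)"
  shows "f differentiable (at x)"
  using assms has_derivative_transform_within_open unfolding differentiable_def by metis

text \<open>Taking components reduces the symmetry of second derivatives to real-valued
  functions.\<close>

lemma Ck_on_inner:
  fixes f :: "'a::real_normed_vector \<Rightarrow> 'b::real_inner"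
  assumes "open U" "Ck_on k f U"
  shows "Ck_on k (\<lambda>z. f z \<bullet> b) U"
  using assms(2)
proof (induction k arbitrary: f)
  case 0
  then show ?case by (auto intro: continuous_intros)
next
  case (Suc k)
  \<comment> \<open>The derivative of a component is known to be the component of the derivative
    only on \<open>U\<close>; the induction therefore uses that, on an open set,
    \<open>Ck_on\<close> depends only on the values there.\<close>
  have cong: "Ck_on k p U \<longleftrightarrow> Ck_on k q U" if "\<And>y. y \<in> U \<Longrightarrow> p y = q y" for p q :: "'a \<Rightarrow> real"
    using that
  proof (induction k arbitrary: p q)
    case 0
    then show ?case by (auto cong: continuous_on_cong)
  next
    case (Suc k)
    have "(\<lambda>x. frechet_derivative p (at x) v) y = (\<lambda>x. frechet_derivative q (at x) v) y" if "y \<in> U" for v y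
      using frechet_derivative_cong_open[OF assms(1) that, of p q] Suc.prems by simp
    then have "Ck_on k (\<lambda>x. frechet_derivative p (at x) v) U \<longleftrightarrow>
      Ck_on k (\<lambda>x. frechet_derivative q (at x) v) U" for v
      by (rule Suc.IH)
    moreover have "p differentiable (at x) \<longleftrightarrow> q differentiable (at x)" if "x \<in> U" for x
      using differentiable_cong_open[OF assms(1) that] Suc.prems by metis
    ultimately show ?case by auto
  qed
  have "Ck_on k (\<lambda>x. frechet_derivative f (at x) v \<bullet> b) U" for v
    using Suc by auto
  moreover have "frechet_derivative (\<lambda>z. f z \<bullet> b) (at x) v = frechet_derivative f (at x) v \<bullet> b" if "x \<in> U" for x v
    using Suc.prems that by (auto intro: frechet_derivative_inner)
  ultimately have "Ck_on k (\<lambda>x. frechet_derivative (\<lambda>z. f z \<bullet> b) (at x) v) U" for v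
    by (subst cong[of _ "\<lambda>x. frechet_derivative f (at x) v \<bullet> b" for v]) auto
  then show ?case using Suc.prems frechet_derivative_inner(2) by auto
qed

lemma second_derivative_symmetric:
  fixes f :: "'a::real_normed_vector \<Rightarrow> 'b::euclidean_space"
  assumes f: "smooth_on f U" and U: "open U" "x \<in> U"
  shows "frechet_derivative (\<lambda>z. frechet_derivative f (at z) u) (at x) v =
         frechet_derivative (\<lambda>z. frechet_derivative f (at z) v) (at x) u"
proof (rule euclidean_eqI)
  fix b :: 'b
  have s: "smooth_on (\<lambda>z. f z \<bullet> b) U"
    using f Ck_on_inner[OF U(1)] unfolding smooth_on_def by blast
  have *: "frechet_derivative (\<lambda>z. frechet_derivative f (at z) u) (at x) v \<bullet> b =
    frechet_derivative (\<lambda>z. frechet_derivative (\<lambda>z. f z \<bullet> b) (at z) u) (at x) v" for u v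
  proof -
    have "frechet_derivative (\<lambda>z. frechet_derivative (\<lambda>z. f z \<bullet> b) (at z) u) (at x) v
      = frechet_derivative (\<lambda>z. frechet_derivative f (at z) u \<bullet> b) (at x) v"
      by (rule fun_cong[OF frechet_derivative_cong_open[OF U]])
         (simp add: frechet_derivative_inner smooth_onD[OF f])
    then show ?thesis
      by (simp add: frechet_derivative_inner smooth_onD[OF smooth_on_frechet_derivative[OF f] U(2)])
  qed
  show "frechet_derivative (\<lambda>z. frechet_derivative f (at z) u) (at x) v \<bullet> b =
        frechet_derivative (\<lambda>z. frechet_derivative f (at z) v) (at x) u \<bullet> b"
    unfolding * by (rule second_derivative_symmetric_real[OF s U])
qed

section \<open>Non-degenerate forms\<close>

lemma metric_atD:
  assumes "metric_at b"
  shows "bilinear b" "b u v = b v u" "(\<And>v. b u v = 0) \<Longrightarrow> u = 0"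
  using assms unfolding metric_at_def by auto

lemma metric_at_eqI:
  assumes "metric_at b" "\<And>w. b u w = b v w"
  shows "u = v"
proof -
  have "b (u - v) w = 0" for w
    using assms(2)[of w] bilinear_lsub[OF metric_atD(1)[OF assms(1)]] by simp
  then show ?thesis using metric_atD(3)[OF assms(1), of "u - v"] by simp
qed

lemma bilinear_basis_expansion:
  fixes b :: "'a::euclidean_space \<Rightarrow> 'b::euclidean_space \<Rightarrow> 'c::real_vector"
  assumes "bilinear b"
  shows "b u v = (\<Sum>i\<in>Basis. \<Sum>j\<in>Basis. ((u \<bullet> i) * (v \<bullet> j)) *\<^sub>R b i j)"
proof -
  have "b u v = b (\<Sum>i\<in>Basis. (u \<bullet> i) *\<^sub>R i) (\<Sum>j\<in>Basis. (v \<bullet> j) *\<^sub>R j)"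
    by (simp add: euclidean_representation)
  also have "\<dots> = (\<Sum>(i,j)\<in>Basis \<times> Basis. b ((u \<bullet> i) *\<^sub>R i) ((v \<bullet> j) *\<^sub>R j))"
    by (rule bilinear_sum[OF assms])
  also have "\<dots> = (\<Sum>i\<in>Basis. \<Sum>j\<in>Basis. b ((u \<bullet> i) *\<^sub>R i) ((v \<bullet> j) *\<^sub>R j))"
    by (simp add: sum.cartesian_product)
  finally show ?thesis by (simp add: bilinear_lmul[OF assms] bilinear_rmul[OF assms] mult.commute)
qed

text \<open>Relative to the Euclidean inner product, \<open>b\<close> is a linear operator
  \<open>M\<close>; non-degeneracy makes \<open>M\<close> injective, hence surjective in finite
  dimension.\<close>

lemma metric_riesz:
  fixes b :: "'a::euclidean_space bilin"
  assumes "metric_at b" "linear l"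
  shows "\<exists>!W. \<forall>Y. b W Y = l Y"
proof -
  note b = metric_atD[OF assms(1)]
  define M where "M W = (\<Sum>i\<in>Basis. b W i *\<^sub>R i)" for W
  have M: "M W \<bullet> Y = b W Y" for W Y
  proof -
    have "b W Y = b W (\<Sum>i\<in>Basis. (Y \<bullet> i) *\<^sub>R i)" by (simp add: euclidean_representation)
    also have "\<dots> = (\<Sum>i\<in>Basis. (Y \<bullet> i) * b W i)"
      using b(1) by (simp add: linear_sum linear_scale bilinear_def)
    finally show ?thesis by (simp add: M_def inner_sum_right inner_commute[of _ Y] mult.commute)
  qed
  have "linear M"
  proof
    show "M (u + v) = M u + M v" for u v
      by (rule euclidean_eqI) (simp add: M inner_add_left bilinear_ladd[OF b(1)])
    show "M (r *\<^sub>R u) = r *\<^sub>R M u" for r u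
      by (rule euclidean_eqI) (simp add: M bilinear_lmul[OF b(1)])
  qed
  moreover have "inj M" using M metric_at_eqI[OF assms(1)] unfolding inj_def by metis
  ultimately have "surj M" by (rule linear_inj_imp_surj)
  then obtain W where W: "M W = (\<Sum>i\<in>Basis. l i *\<^sub>R i)" by (metis surjD)
  have "b W Y = l Y" for Y
  proof -
    have "b W Y = (\<Sum>i\<in>Basis. l i *\<^sub>R i) \<bullet> Y" using M W by metis
    also have "\<dots> = (\<Sum>i\<in>Basis. (Y \<bullet> i) *\<^sub>R l i)"
      by (simp add: inner_sum_right inner_commute[of _ Y] mult.commute)
    also have "\<dots> = l (\<Sum>i\<in>Basis. (Y \<bullet> i) *\<^sub>R i)"
      by (simp add: linear_sum[OF assms(2)] linear_scale[OF assms(2)])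
    finally show ?thesis by (simp add: euclidean_representation)
  qed
  then show ?thesis using metric_at_eqI[OF assms(1)] by metis
qed

section \<open>Differentiable dependence of vectors represented through a metric\<close>

lemma differentiable_prod:
  fixes f :: "'i \<Rightarrow> 'a::real_normed_vector \<Rightarrow> real"
  assumes "\<And>i. i \<in> I \<Longrightarrow> f i differentiable (at x)"
  shows "(\<lambda>y. \<Prod>i\<in>I. f i y) differentiable (at x)"
  using has_derivative_prod[of I f "\<lambda>i. frechet_derivative (f i) (at x)" x UNIV]
    assms frechet_derivative_works unfolding differentiable_def by blast

lemma differentiable_det:
  fixes A :: "'a::real_normed_vector \<Rightarrow> real^'n^'n"
  assumes "\<And>i j. (\<lambda>y. A y $ i $ j) differentiable (at x)"
  shows "(\<lambda>y. det (A y)) differentiable (at x)"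
  unfolding det_def
  by (intro differentiable_sum ballI differentiable_mult differentiable_const differentiable_prod assms)
     (simp_all add: finite_permutations)

text \<open>Cramer's rule expresses the solution rationally in the entries of \<open>A\<close> and
  \<open>b\<close>.\<close>

lemma differentiable_linear_system_solution:
  fixes A :: "'a::real_normed_vector \<Rightarrow> real^'n^'n" and W :: "'a \<Rightarrow> real^'n"
  assumes U: "open U" "x \<in> U"
    and A: "\<And>i j. (\<lambda>y. A y $ i $ j) differentiable (at x)" "\<And>y. y \<in> U \<Longrightarrow> det (A y) \<noteq> 0"
    and b: "\<And>i. (\<lambda>y. b y $ i) differentiable (at x)"
    and W: "\<And>y. y \<in> U \<Longrightarrow> A y *v W y = b y"
  shows "W differentiable (at x)"
proof -
  have "W y = (\<Sum>k\<in>UNIV. (det (\<chi> i j. if j = k then b y $ i else A y $ i $ j) / det (A y)) *\<^sub>R axis k 1)"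
    if "y \<in> U" for y
  proof -
    have "W y = (\<chi> k. det (\<chi> i j. if j = k then b y $ i else A y $ i $ j) / det (A y))"
      using W[OF that] A(2)[OF that] by (simp add: cramer)
    also have "\<dots> = (\<Sum>k\<in>UNIV. (det (\<chi> i j. if j = k then b y $ i else A y $ i $ j) / det (A y)) *\<^sub>R axis k 1)"
      by (subst basis_expansion[symmetric]) (simp add: scalar_mult_eq_scaleR)
    finally show ?thesis .
  qed
  moreover have "(\<lambda>y. \<Sum>k\<in>UNIV. (det (\<chi> i j. if j = k then b y $ i else A y $ i $ j) / det (A y))
      *\<^sub>R (axis k 1 :: real^'n)) differentiable (at x)"
  proof (intro differentiable_sum ballI differentiable_scaleR differentiable_divide differentiable_det A(1)
        A(2) U differentiable_const finite)
    show "(\<lambda>y. (\<chi> i j. if j = k then b y $ i else A y $ i $ j) $ i $ j) differentiable at x" for k i j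
      by (cases "j = k") (use A b in auto)
  qed
  ultimately show ?thesis by (rule differentiable_cong_open[OF U])
qed

definition gram :: "(real^'n) bilin \<Rightarrow> real^'n^'n" where
  "gram b = (\<chi> i j. b (axis i 1) (axis j 1))"

lemma gram_mult:
  assumes "bilinear b"
  shows "(gram b *v v) $ i = b (axis i 1) v"
proof -
  have "b (axis i 1) v = b (axis i 1) (\<Sum>j\<in>UNIV. v $ j *\<^sub>R axis j 1)"
    using basis_expansion[of v] by (simp add: scalar_mult_eq_scaleR)
  also have "\<dots> = (\<Sum>j\<in>UNIV. v $ j * b (axis i 1) (axis j 1))"
    using assms by (simp add: linear_sum linear_scale bilinear_def)
  finally show ?thesis by (simp add: gram_def matrix_vector_mult_def mult.commute)
qed

lemma bilinear_gram:
  assumes "bilinear b"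
  shows "b u v = u \<bullet> (gram b *v v)"
proof -
  have "b u v = b (\<Sum>j\<in>UNIV. u $ j *\<^sub>R axis j 1) v"
    using basis_expansion[of u] by (simp add: scalar_mult_eq_scaleR)
  also have "\<dots> = (\<Sum>j\<in>UNIV. u $ j * b (axis j 1) v)"
    using assms by (simp add: linear_sum[of "\<lambda>u. b u v"] linear_scale[of "\<lambda>u. b u v"] bilinear_def)
  finally show ?thesis by (simp add: inner_vec_def gram_mult[OF assms])
qed

lemma det_gram_nonzero:
  assumes "metric_at b"
  shows "det (gram b) \<noteq> 0"
proof -
  note b = metric_atD[OF assms]
  have "v = 0" if "gram b *v v = 0" for v
  proof (rule b(3))
    show "b v w = 0" for w using bilinear_gram[OF b(1), of w v] that b(2) by simp
  qed
  then show ?thesis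
    using matrix_left_invertible_ker[of "gram b"] invertible_det_nz[of "gram b"]
      invertible_left_inverse[of "gram b"] by blast
qed

text \<open>Meant for vectors given only pointwise by their pairing with the metric, such as the
  Christoffel map. The pairing is a linear system whose matrix, the Gram matrix, is invertible by
  non-degeneracy.\<close>

lemma differentiable_riesz:
  fixes G :: "'a::real_normed_vector \<Rightarrow> (real^'n) bilin"
  assumes U: "open U" "x \<in> U"
    and G: "\<And>y. y \<in> U \<Longrightarrow> metric_at (G y)" "\<And>u v. (\<lambda>y. G y u v) differentiable (at x)"
    and l: "\<And>v. (\<lambda>y. l y v) differentiable (at x)"
    and W: "\<And>y v. y \<in> U \<Longrightarrow> G y (W y) v = l y v"
  shows "W differentiable (at x)"
proof (rule differentiable_linear_system_solution[OF U, where A = "\<lambda>y. gram (G y)"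
      and b = "\<lambda>y. \<chi> i. l y (axis i 1)"])
  show "(\<lambda>y. gram (G y) $ i $ j) differentiable at x" for i j
    by (simp add: gram_def G)
  show "gram (G y) *v W y = (\<chi> i. l y (axis i 1))" if "y \<in> U" for y
    by (simp add: vec_eq_iff gram_mult[OF metric_atD(1)[OF G(1)[OF that]]] W[OF that, symmetric])
       (simp add: metric_atD(2)[OF G(1)[OF that], of "axis _ _"])
qed (simp_all add: det_gram_nonzero G l)

text \<open>Expansion in bases reduces this product rule to the finitely many coefficient functions
  \<open>B y i j\<close>.\<close>

lemma has_derivative_bilinear_family:
  fixes B :: "'a::real_normed_vector \<Rightarrow> 'b::euclidean_space \<Rightarrow> 'c::euclidean_space \<Rightarrow> 'd::real_normed_vector"
  assumes U: "open U" "x \<in> U"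
    and B: "\<And>y. y \<in> U \<Longrightarrow> bilinear (B y)" "\<And>u v. (\<lambda>y. B y u v) differentiable (at x)"
    and a: "(a has_derivative a') (at x)" and b: "(b has_derivative b') (at x)"
  shows "((\<lambda>y. B y (a y) (b y)) has_derivative
    (\<lambda>d. frechet_derivative (\<lambda>y. B y (a x) (b x)) (at x) d + B x (a' d) (b x) + B x (a x) (b' d))) (at x)"
proof -
  define D where "D = (\<lambda>i j. frechet_derivative (\<lambda>y. B y i j) (at x))"
  have D: "((\<lambda>y. B y i j) has_derivative D i j) (at x)" for i j
    unfolding D_def using B(2) frechet_derivative_works by blast
  have expand: "((\<lambda>y. B y (p y) (q y)) has_derivative
      (\<lambda>d. \<Sum>i\<in>Basis. \<Sum>j\<in>Basis. ((p x \<bullet> i) * (q x \<bullet> j)) *\<^sub>R D i j d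
        + ((p x \<bullet> i) * (q' d \<bullet> j) + (p' d \<bullet> i) * (q x \<bullet> j)) *\<^sub>R B x i j)) (at x)"
    if p: "(p has_derivative p') (at x)" and q: "(q has_derivative q') (at x)" for p p' q q'
  proof (rule has_derivative_transform_within_open[OF _ U])
    show "((\<lambda>y. \<Sum>i\<in>Basis. \<Sum>j\<in>Basis. ((p y \<bullet> i) * (q y \<bullet> j)) *\<^sub>R B y i j) has_derivative
      (\<lambda>d. \<Sum>i\<in>Basis. \<Sum>j\<in>Basis. ((p x \<bullet> i) * (q x \<bullet> j)) *\<^sub>R D i j d
        + ((p x \<bullet> i) * (q' d \<bullet> j) + (p' d \<bullet> i) * (q x \<bullet> j)) *\<^sub>R B x i j)) (at x)"
      by (intro has_derivative_sum has_derivative_scaleR has_derivative_mult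
          has_derivative_inner_left D p q)
  qed (simp add: bilinear_basis_expansion[OF B(1)])
  \<comment> \<open>Constant arguments in \<open>expand\<close> single out the part that
    differentiates \<open>B\<close> itself.\<close>
  have Dx: "frechet_derivative (\<lambda>y. B y u v) (at x) d =
      (\<Sum>i\<in>Basis. \<Sum>j\<in>Basis. ((u \<bullet> i) * (v \<bullet> j)) *\<^sub>R D i j d)" for u v d
    using frechet_eqI[OF expand[of "\<lambda>_. u" "\<lambda>_. 0" "\<lambda>_. v" "\<lambda>_. 0"]] by simp
  show ?thesis
    using expand[OF a b]
    by (rule has_derivative_eq_rhs)
       (simp add: fun_eq_iff Dx bilinear_basis_expansion[OF B(1)[OF U(2)], of "a' _" "b x"]
         bilinear_basis_expansion[OF B(1)[OF U(2)], of "a x" "b' _"] sum.distrib scaleR_left_distrib)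
qed

section \<open>The Levi-Civita connection in a chart\<close>

text \<open>The pullback connection on vector fields along \<open>F\<close>. For \<open>F\<close>
  the identity it is the covariant derivative in the constant direction \<open>u\<close>.\<close>

definition cov_along ::
  "('b::euclidean_space \<Rightarrow> 'b bilin) \<Rightarrow> ('a::euclidean_space \<Rightarrow> 'b) \<Rightarrow> 'a \<Rightarrow> ('a \<Rightarrow> 'b) \<Rightarrow> 'a \<Rightarrow> 'b" where
  "cov_along G F u W x =
     frechet_derivative W (at x) u + christoffel G (F x) (frechet_derivative F (at x) u) (W x)"

lemma has_derivative_imp_linear_frechet:
  "f differentiable (at x) \<Longrightarrow> linear (\<lambda>u. frechet_derivative f (at x) u)"
  using linear_frechet_derivative by auto

lemma smooth_on_const: "smooth_on (\<lambda>_. c) U"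
proof -
  have "Ck_on k (\<lambda>_. c) U" for k
    by (induction k arbitrary: c) (auto simp: continuous_on_const)
  then show ?thesis unfolding smooth_on_def by blast
qed

lemma cov_along_cong_open:
  assumes "open U" "x \<in> U" "\<And>y. y \<in> U \<Longrightarrow> A y = B y"
  shows "cov_along G F u A x = cov_along G F u B x"
  using frechet_derivative_cong_open[OF assms] assms by (simp add: cov_along_def)

text \<open>The difference of \<open>T\<close> and \<open>T'\<close> is symmetric in the first two
  slots and skew in the last two, hence zero. This gives uniqueness of the Levi-Civita connection
  and later identifies the tangential part of the ambient derivative.\<close>

lemma koszul_unique:
  fixes T T' :: "'a \<Rightarrow> 'a \<Rightarrow> 'a \<Rightarrow> real"
  assumes "\<And>u v w. T u v w = T v u w" "\<And>u v w. T' u v w = T' v u w"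
    and "\<And>u v w. T u v w + T u w v = T' u v w + T' u w v"
  shows "T u v w = T' u v w"
  using assms(3)[of u v w] assms(3)[of v u w] assms(3)[of w u v]
    assms(1)[of u v w] assms(1)[of v w u] assms(1)[of w u v]
    assms(2)[of u v w] assms(2)[of v w u] assms(2)[of w u v] by linarith

locale chart_metric =
  fixes G :: "real^'n \<Rightarrow> (real^'n) bilin" and U :: "(real^'n) set"
  assumes open_dom: "open U"
    and metric: "x \<in> U \<Longrightarrow> metric_at (G x)"
    and smooth: "smooth_on (\<lambda>x. G x u v) U"
begin

abbreviation dG :: "real^'n \<Rightarrow> real^'n \<Rightarrow> real^'n \<Rightarrow> real^'n \<Rightarrow> real" where
  "dG x u v w \<equiv> frechet_derivative (\<lambda>y. G y v w) (at x) u"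

lemma G_bilinear: "x \<in> U \<Longrightarrow> bilinear (G x)"
  and G_sym: "x \<in> U \<Longrightarrow> G x u v = G x v u"
  using metric metric_atD by blast+

lemmas G_simps = bilinear_ladd[OF G_bilinear] bilinear_radd[OF G_bilinear]
  bilinear_lsub[OF G_bilinear] bilinear_rsub[OF G_bilinear]
  bilinear_lmul[OF G_bilinear] bilinear_rmul[OF G_bilinear]
  bilinear_lzero[OF G_bilinear] bilinear_rzero[OF G_bilinear]

lemma G_differentiable: "x \<in> U \<Longrightarrow> (\<lambda>y. G y u v) differentiable (at x)"
  using smooth_onD[OF smooth] .

lemma dG_sym: "x \<in> U \<Longrightarrow> dG x u v w = dG x u w v"
  using frechet_derivative_cong_open[OF open_dom, of x "\<lambda>y. G y v w" "\<lambda>y. G y w v"] G_sym by metis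

lemma linear_dG_1: "x \<in> U \<Longrightarrow> linear (\<lambda>u. dG x u v w)"
  by (intro has_derivative_imp_linear_frechet G_differentiable)

lemma dG_add: "x \<in> U \<Longrightarrow> dG x u v (w + w') = dG x u v w + dG x u v w'"
proof -
  assume x: "x \<in> U"
  have "((\<lambda>y. G y v (w + w')) has_derivative (\<lambda>u. dG x u v w + dG x u v w')) (at x)"
    by (rule has_derivative_transform_within_open[OF _ open_dom x])
       (auto intro!: has_derivative_add has_derivative_frechet G_differentiable x simp: G_simps)
  then show ?thesis by (rule frechet_eqI)
qed

lemma dG_scale: "x \<in> U \<Longrightarrow> dG x u v (c *\<^sub>R w) = c * dG x u v w"
proof -
  assume x: "x \<in> U"
  have "((\<lambda>y. G y v (c *\<^sub>R w)) has_derivative (\<lambda>u. c * dG x u v w)) (at x)"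
    by (rule has_derivative_transform_within_open[OF _ open_dom x])
       (auto intro!: has_derivative_mult_right has_derivative_frechet G_differentiable x simp: G_simps)
  then show ?thesis by (rule frechet_eqI)
qed

lemma dG_add_left: "x \<in> U \<Longrightarrow> dG x u (v + w) z = dG x u v z + dG x u w z"
  and dG_scale_left: "x \<in> U \<Longrightarrow> dG x u (c *\<^sub>R v) z = c * dG x u v z"
  by (simp_all add: dG_sym[of x _ z] dG_add dG_scale)

text \<open>The definite description in \<open>christoffel\<close> is justified here: the Koszul
  formula with Riesz representation gives existence, \<open>koszul_unique\<close> gives
  uniqueness.\<close>

lemma christoffel_works:
  assumes x: "x \<in> U"
  shows "bilinear (christoffel G x) \<and> (\<forall>u v. christoffel G x u v = christoffel G x v u) \<and>
     (\<forall>u v w. dG x u v w = G x (christoffel G x u v) w + G x v (christoffel G x u w))"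
proof -
  note m = metric[OF x]
  \<comment> \<open>The right-hand side of the Koszul formula for fields with constant coordinates,
    whose brackets vanish.\<close>
  define l where "l = (\<lambda>u v w. (dG x u v w + dG x v u w - dG x w u v) / 2)"
  have l: "linear (l u v)" for u v
    unfolding l_def
    by (rule linearI)
       (simp_all add: dG_add[OF x] dG_scale[OF x] linear_add[OF linear_dG_1[OF x]]
          linear_scale[OF linear_dG_1[OF x]] field_simps)
  define \<Gamma> where "\<Gamma> = (\<lambda>u v. SOME W. \<forall>w. G x W w = l u v w)"
  have \<Gamma>: "G x (\<Gamma> u v) w = l u v w" for u v w
    unfolding \<Gamma>_def using someI_ex[OF ex1_implies_ex[OF metric_riesz[OF m l]]] by blast
  have sym: "\<Gamma> u v = \<Gamma> v u" for u v
  proof (rule metric_at_eqI[OF m])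
    show "G x (\<Gamma> u v) w = G x (\<Gamma> v u) w" for w
      using dG_sym[OF x, of u v w] unfolding \<Gamma> l_def by simp
  qed
  have radd: "\<Gamma> u (v + w) = \<Gamma> u v + \<Gamma> u w" for u v w
    by (rule metric_at_eqI[OF m])
       (simp add: \<Gamma> G_simps[OF x] l_def dG_add[OF x] dG_add_left[OF x] linear_add[OF linear_dG_1[OF x]] field_simps)
  have rscale: "\<Gamma> u (c *\<^sub>R v) = c *\<^sub>R \<Gamma> u v" for u v c
    by (rule metric_at_eqI[OF m])
       (simp add: \<Gamma> G_simps[OF x] l_def dG_scale[OF x] dG_scale_left[OF x]
          linear_scale[OF linear_dG_1[OF x]] field_simps)
  have bil: "bilinear \<Gamma>"
  proof -
    have "\<Gamma> (v + w) u = \<Gamma> v u + \<Gamma> w u" "\<Gamma> (c *\<^sub>R v) u = c *\<^sub>R \<Gamma> v u" for u v w c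
      by (simp_all only: sym[of _ u] radd rscale)
    then show ?thesis
      unfolding bilinear_def by (intro conjI allI linearI) (auto simp: radd rscale)
  qed
  have compat: "dG x u v w = G x (\<Gamma> u v) w + G x v (\<Gamma> u w)" for u v w
  proof -
    have "dG x u w v = dG x u v w" "dG x v w u = dG x v u w" "dG x w v u = dG x w u v"
      using dG_sym[OF x] by auto
    then show ?thesis
      unfolding G_sym[OF x, of v] \<Gamma> l_def by (simp add: field_simps)
  qed
  have "\<exists>!\<Gamma>. bilinear \<Gamma> \<and> (\<forall>u v. \<Gamma> u v = \<Gamma> v u) \<and>
      (\<forall>u v w. dG x u v w = G x (\<Gamma> u v) w + G x v (\<Gamma> u w))"
  proof (rule ex1I[of _ \<Gamma>])
    show "bilinear \<Gamma> \<and> (\<forall>u v. \<Gamma> u v = \<Gamma> v u) \<and>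
      (\<forall>u v w. dG x u v w = G x (\<Gamma> u v) w + G x v (\<Gamma> u w))"
      using bil sym compat by blast
    fix \<Gamma>' assume a: "bilinear \<Gamma>' \<and> (\<forall>u v. \<Gamma>' u v = \<Gamma>' v u) \<and>
      (\<forall>u v w. dG x u v w = G x (\<Gamma>' u v) w + G x v (\<Gamma>' u w))"
    have eq: "G x (\<Gamma>' u v) w = G x (\<Gamma> u v) w" for u v w
    proof (rule koszul_unique[where T = "\<lambda>u v w. G x (\<Gamma>' u v) w" and T' = "\<lambda>u v w. G x (\<Gamma> u v) w"])
      show "G x (\<Gamma>' u v) w = G x (\<Gamma>' v u) w" for u v w
        using a by (metis (no_types))
      show "G x (\<Gamma> u v) w = G x (\<Gamma> v u) w" for u v w
        by (simp only: sym[of u v])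
      have "dG x u v w = G x (\<Gamma>' u v) w + G x v (\<Gamma>' u w)" for u v w
        using a by blast
      note c = this
      show "G x (\<Gamma>' u v) w + G x (\<Gamma>' u w) v = G x (\<Gamma> u v) w + G x (\<Gamma> u w) v" for u v w
        using c[of v w u] compat[of v w u] G_sym[OF x, of v "\<Gamma> u w"] G_sym[OF x, of v "\<Gamma>' u w"] by linarith
    qed
    show "\<Gamma>' = \<Gamma>" using metric_at_eqI[OF m eq] by blast
  qed
  then show ?thesis unfolding christoffel_def by (rule theI')
qed

abbreviation \<Gamma> :: "real^'n \<Rightarrow> real^'n \<Rightarrow> real^'n \<Rightarrow> real^'n" where
  "\<Gamma> x \<equiv> christoffel G x"

lemma christoffel_bilinear: "x \<in> U \<Longrightarrow> bilinear (\<Gamma> x)"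
  and christoffel_sym: "x \<in> U \<Longrightarrow> \<Gamma> x u v = \<Gamma> x v u"
  and christoffel_compat: "x \<in> U \<Longrightarrow> dG x u v w = G x (\<Gamma> x u v) w + G x v (\<Gamma> x u w)"
  using christoffel_works by blast+

lemma koszul:
  assumes "x \<in> U"
  shows "G x (\<Gamma> x u v) w = (dG x u v w + dG x v u w - dG x w u v) / 2"
  unfolding christoffel_compat[OF assms]
  using christoffel_sym[OF assms, of u v] christoffel_sym[OF assms, of w u] christoffel_sym[OF assms, of w v]
    G_sym[OF assms, of v "\<Gamma> x u w"] G_sym[OF assms, of u]
  by simp

lemma christoffel_differentiable:
  assumes x: "x \<in> U"
  shows "(\<lambda>y. \<Gamma> y u v) differentiable (at x)"
proof (rule differentiable_riesz[OF open_dom x metric,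
      where l = "\<lambda>y w. (dG y u v w + dG y v u w - dG y w u v) / 2"])
  show "(\<lambda>y. (dG y u v w + dG y v u w - dG y w u v) / 2) differentiable at x" for w
    by (intro differentiable_divide differentiable_diff differentiable_add differentiable_const
        smooth_onD[OF smooth_on_frechet_derivative[OF smooth] x]) simp
  show "(\<lambda>y. G y u v) differentiable at x" for u v
    by (rule G_differentiable[OF x])
qed (simp_all add: koszul)

text \<open>Fields with constant coordinates commute, so the bracket term shrinks to the Christoffel
  map with first argument 0, which vanishes at points of \<open>U\<close>.\<close>

lemma curv_eq:
  "curv G x u v w = cov_along G (\<lambda>y. y) u (\<lambda>y. \<Gamma> y v w) x - cov_along G (\<lambda>y. y) v (\<lambda>y. \<Gamma> y u w) x
    - \<Gamma> x 0 w"
  by (simp add: curv_def curvature_fields_def cov_deriv_def[abs_def] lie_bracket_def[abs_def] cov_along_def)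

section \<open>Covariant differentiation along a map\<close>

lemma has_derivative_compose_frechet:
  assumes "f differentiable (at (F x))" "F differentiable (at x)"
  shows "((\<lambda>y. f (F y)) has_derivative
    (\<lambda>d. frechet_derivative f (at (F x)) (frechet_derivative F (at x) d))) (at x)"
  by (rule has_derivative_compose[OF has_derivative_frechet[OF assms(2)] has_derivative_frechet[OF assms(1)]])

text \<open>By compatibility, the derivative of \<open>G\<close> at the moving base point splits
  into two Christoffel terms, which complete the plain derivatives of \<open>A\<close> and
  \<open>B\<close> to covariant ones.\<close>

lemma has_derivative_metric_along:
  fixes F :: "real^'k \<Rightarrow> real^'n"
  assumes V: "open V" "x \<in> V" "F ` V \<subseteq> U"
    and d: "F differentiable (at x)" "A differentiable (at x)" "B differentiable (at x)"
  shows "((\<lambda>y. G (F y) (A y) (B y)) has_derivative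
    (\<lambda>u. G (F x) (cov_along G F u A x) (B x) + G (F x) (A x) (cov_along G F u B x))) (at x)"
proof -
  have Fx: "F x \<in> U" using V by blast
  have GF: "((\<lambda>y. G (F y) v w) has_derivative (\<lambda>d. dG (F x) (frechet_derivative F (at x) d) v w)) (at x)" for v w
    by (rule has_derivative_compose_frechet[OF G_differentiable[OF Fx] d(1)])
  have "((\<lambda>y. G (F y) (A y) (B y)) has_derivative
    (\<lambda>u. dG (F x) (frechet_derivative F (at x) u) (A x) (B x)
      + G (F x) (frechet_derivative A (at x) u) (B x) + G (F x) (A x) (frechet_derivative B (at x) u))) (at x)"
    using has_derivative_bilinear_family[OF V(1,2), of "\<lambda>y. G (F y)" A "\<lambda>u. frechet_derivative A (at x) u"
        B "\<lambda>u. frechet_derivative B (at x) u"]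
    using V(3) GF by (auto simp: G_bilinear differentiableI[OF GF] has_derivative_frechet d frechet_eqI[OF GF]
        image_subset_iff)
  then show ?thesis
    by (simp add: cov_along_def G_simps[OF Fx] christoffel_compat[OF Fx] algebra_simps)
qed

lemma cov_along_derivative:
  fixes F :: "real^'k \<Rightarrow> real^'n"
  assumes V: "open V" "x \<in> V" "F ` V \<subseteq> U"
    and F: "smooth_on F V" and W: "smooth_on W V"
  shows "(cov_along G F v W has_derivative (\<lambda>u.
      frechet_derivative (\<lambda>y. frechet_derivative W (at y) v) (at x) u
      + (frechet_derivative (\<lambda>q. \<Gamma> q (frechet_derivative F (at x) v) (W x)) (at (F x)) (frechet_derivative F (at x) u)
      + \<Gamma> (F x) (frechet_derivative (\<lambda>y. frechet_derivative F (at y) v) (at x) u) (W x)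
      + \<Gamma> (F x) (frechet_derivative F (at x) v) (frechet_derivative W (at x) u)))) (at x)"
proof -
  have Fx: "F x \<in> U" using V by blast
  have GF: "((\<lambda>y. \<Gamma> (F y) a b) has_derivative
      (\<lambda>d. frechet_derivative (\<lambda>q. \<Gamma> q a b) (at (F x)) (frechet_derivative F (at x) d))) (at x)" for a b
    by (rule has_derivative_compose_frechet[OF christoffel_differentiable[OF Fx] smooth_onD[OF F V(2)]])
  have "((\<lambda>y. \<Gamma> (F y) (frechet_derivative F (at y) v) (W y)) has_derivative
    (\<lambda>u. frechet_derivative (\<lambda>q. \<Gamma> q (frechet_derivative F (at x) v) (W x)) (at (F x)) (frechet_derivative F (at x) u)
      + \<Gamma> (F x) (frechet_derivative (\<lambda>y. frechet_derivative F (at y) v) (at x) u) (W x)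
      + \<Gamma> (F x) (frechet_derivative F (at x) v) (frechet_derivative W (at x) u))) (at x)"
    using has_derivative_bilinear_family[OF V(1,2), of "\<lambda>y. \<Gamma> (F y)"
        "\<lambda>y. frechet_derivative F (at y) v" "\<lambda>u. frechet_derivative (\<lambda>y. frechet_derivative F (at y) v) (at x) u"
        W "\<lambda>u. frechet_derivative W (at x) u"]
    using V(3) smooth_onD[OF W V(2)] smooth_onD[OF smooth_on_frechet_derivative[OF F] V(2)]
    by (auto simp: christoffel_bilinear differentiableI[OF GF] has_derivative_frechet frechet_eqI[OF GF]
        image_subset_iff)
  then show ?thesis unfolding cov_along_def[abs_def]
    by (intro has_derivative_add has_derivative_frechet smooth_onD[OF smooth_on_frechet_derivative[OF W] V(2)])
qed

text \<open>The second derivatives of \<open>F\<close> and \<open>W\<close> cancel by their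
  symmetry, and the terms with one derivative of \<open>W\<close> are symmetric in \<open>u\<close>
  and \<open>v\<close>. What remains is the curvature on constant fields at
  \<open>F x\<close>.\<close>

lemma curv_along:
  fixes F :: "real^'k \<Rightarrow> real^'n"
  assumes V: "open V" "x \<in> V" "F ` V \<subseteq> U"
    and F: "smooth_on F V" and W: "smooth_on W V"
  shows "cov_along G F u (cov_along G F v W) x - cov_along G F v (cov_along G F u W) x =
    curv G (F x) (frechet_derivative F (at x) u) (frechet_derivative F (at x) v) (W x)"
proof -
  have Fx: "F x \<in> U" using V by blast
  note d = frechet_eqI[OF cov_along_derivative[OF assms]]
  note \<Gamma>_simps = bilinear_radd[OF christoffel_bilinear[OF Fx]] bilinear_lzero[OF christoffel_bilinear[OF Fx]]
  show ?thesis
    unfolding curv_eq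
    by (simp add: cov_along_def[of G F u "cov_along G F v W"] cov_along_def[of G F v "cov_along G F u W"] d)
       (simp add: cov_along_def \<Gamma>_simps second_derivative_symmetric[OF F V(1,2), of u v]
         second_derivative_symmetric[OF W V(1,2), of u v])
qed

end

section \<open>Curvature tensors and the Gauss equation\<close>

text \<open>Algebraic curvature tensors. Linearity is required in the first slot; the symmetries
  carry it to the other slots.\<close>

definition curvature_like :: "'a::real_vector tensor4 \<Rightarrow> bool" where
  "curvature_like T \<longleftrightarrow>
     (\<forall>v w z. linear (\<lambda>u. T u v w z)) \<and>
     (\<forall>u v w z. T u v w z = - T v u w z) \<and>
     (\<forall>u v w z. T u v w z = - T u v z w) \<and>
     (\<forall>u v w z. T u v w z + T v w u z + T w u v z = 0)"

lemma curvature_likeD: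
  assumes "curvature_like T"
  shows "T (u + u') v w z = T u v w z + T u' v w z" "T (c *\<^sub>R u) v w z = c * T u v w z"
    "T u v w z = - T v u w z" "T u v w z = - T u v z w" "T u v w z + T v w u z + T w u v z = 0"
proof -
  note T = assms[unfolded curvature_like_def]
  have "linear (\<lambda>u. T u v w z)" using T by blast
  from linear_add[OF this] linear_scale[OF this]
  show "T (u + u') v w z = T u v w z + T u' v w z" "T (c *\<^sub>R u) v w z = c * T u v w z" by simp_all
  show "T u v w z = - T v u w z" "T u v w z = - T u v z w" "T u v w z + T v w u z + T w u v z = 0"
    using T by blast+
qed

text \<open>The octahedron argument: the Bianchi identities for the four choices of the last
  argument are combined, and the antisymmetries cancel everything else.\<close>

lemma curvature_like_pair_symmetry:
  assumes "curvature_like T"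
  shows "T u v w z = T w z u v"
  using curvature_likeD(5)[OF assms, of u v w z] curvature_likeD(5)[OF assms, of v w z u]
    curvature_likeD(5)[OF assms, of w z u v] curvature_likeD(5)[OF assms, of z u v w]
    curvature_likeD(3)[OF assms, of z v w u] curvature_likeD(3)[OF assms, of z u w v]
    curvature_likeD(3)[OF assms, of u w z v] curvature_likeD(3)[OF assms, of z u v w]
    curvature_likeD(4)[OF assms, of v w z u] curvature_likeD(4)[OF assms, of w z v u]
    curvature_likeD(4)[OF assms, of u z w v] curvature_likeD(4)[OF assms, of w u z v]
    curvature_likeD(4)[OF assms, of u v z w] curvature_likeD(4)[OF assms, of v z u w]
  by linarith

lemma curvature_like_linear:
  assumes "curvature_like T"
  shows "T u (v + v') w z = T u v w z + T u v' w z" "T u (c *\<^sub>R v) w z = c * T u v w z"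
    "T u v (w + w') z = T u v w z + T u v w' z" "T u v (c *\<^sub>R w) z = c * T u v w z"
    "T u v w (z + z') = T u v w z + T u v w z'" "T u v w (c *\<^sub>R z) = c * T u v w z"
proof -
  note T = curvature_likeD[OF assms] and pair = curvature_like_pair_symmetry[OF assms]
  show a: "T u (v + v') w z = T u v w z + T u v' w z" "T u (c *\<^sub>R v) w z = c * T u v w z" for u v v' w z c
    using T(3)[of u] by (simp_all add: T(1,2))
  show "T u v (w + w') z = T u v w z + T u v w' z" "T u v (c *\<^sub>R w) z = c * T u v w z"
    using pair[of u v] by (simp_all add: T(1,2))
  show "T u v w (z + z') = T u v w z + T u v w z'" "T u v w (c *\<^sub>R z) = c * T u v w z"
    using pair[of u v] by (simp_all add: a)
qed

text \<open>Polarising in the middle and then in the outer pair of slots makes \<open>T\<close> skew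
  under exchange of the middle slots. The three Bianchi terms then coincide, so three times
  \<open>T\<close> vanishes.\<close>

lemma curvature_like_zero:
  assumes "curvature_like T" and sec: "\<And>u v. T u v v u = 0"
  shows "T u v w z = 0"
proof -
  note T = curvature_likeD[OF assms(1)] and pair = curvature_like_pair_symmetry[OF assms(1)]
    and lin = curvature_like_linear[OF assms(1)]
  have 1: "T u v w u = 0" for u v w
    using sec[of u "v + w"] sec[of u v] sec[of u w] pair[of u v w u] T(3)[of w u u v] T(4)[of u w u v]
    by (simp add: lin)
  have 2: "T u v w z = - T z v w u" for u v w z
    using 1[of "u + z" v w] 1[of u v w] 1[of z v w] by (simp add: T(1) lin)
  have "T u v w z = - T u w v z" for u v w z
    using pair[of u v w z] 2[of w z u v] pair[of v z u w] by linarith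
  then show ?thesis
    using T(5)[of u v w z] T(3)[of u v w z] T(3)[of w u v z] by (smt (verit))
qed

text \<open>The curvature tensor of constant curvature one, that is half the Kulkarni-Nomizu square
  of \<open>b\<close>.\<close>

definition const_curv_tensor :: "'a bilin \<Rightarrow> 'a tensor4" where
  "const_curv_tensor b X1 X2 X3 X4 = b X1 X4 * b X2 X3 - b X1 X3 * b X2 X4"

lemma curvature_like_const_curv_tensor:
  assumes "bilinear b" "\<And>u v. b u v = b v u"
  shows "curvature_like (const_curv_tensor b)"
proof -
  have "const_curv_tensor b u v w z + const_curv_tensor b v w u z + const_curv_tensor b w u v z = 0" for u v w z
    using assms(2)[of u v] assms(2)[of u w] assms(2)[of v w] by (simp add: const_curv_tensor_def)
  then show ?thesis
    unfolding curvature_like_def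
    by (auto simp: const_curv_tensor_def bilinear_ladd[OF assms(1)] bilinear_lmul[OF assms(1)]
        intro!: linearI, auto simp: algebra_simps)
qed

lemma curvature_like_diff_scale:
  assumes "curvature_like T" "curvature_like T'"
  shows "curvature_like (\<lambda>u v w z. T u v w z - c * T' u v w z)"
proof -
  note T = curvature_likeD[OF assms(1)] and T' = curvature_likeD[OF assms(2)]
  have "T u v w z - c * T' u v w z + (T v w u z - c * T' v w u z) + (T w u v z - c * T' w u v z)
     = (T u v w z + T v w u z + T w u v z) - c * (T' u v w z + T' v w u z + T' w u v z)" for u v w z
    by (simp add: algebra_simps)
  then have "T u v w z - c * T' u v w z + (T v w u z - c * T' v w u z) + (T w u v z - c * T' w u v z) = 0" for u v w z
    using T(5) T'(5) by simp
  moreover have "linear (\<lambda>u. T u v w z - c * T' u v w z)" for v w z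
    by (rule linearI) (simp_all add: T(1,2) T'(1,2) algebra_simps)
  moreover have "T u v w z - c * T' u v w z = - (T v u w z - c * T' v u w z)" for u v w z
    using T(3)[of u v w z] T'(3)[of u v w z] by simp
  moreover have "T u v w z - c * T' u v w z = - (T u v z w - c * T' u v z w)" for u v w z
    using T(4)[of u v w z] T'(4)[of u v w z] by simp
  ultimately show ?thesis unfolding curvature_like_def by blast
qed

lemma symmetric_form_zero:
  fixes b :: "'a::real_vector bilin"
  assumes "\<And>u v w. b (u + v) w = b u w + b v w" "\<And>u v. b u v = b v u" "\<And>u. b u u = 0"
  shows "b u v = 0"
proof -
  have "b (u + v) (u + v) = b u u + b u v + (b v u + b v v)"
    using assms(1,2) by metis
  then show ?thesis using assms(2)[of u v] assms(3) by simp
qed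

text \<open>Polarisation gives a non-null \<open>u\<close>. If every discriminant with
  \<open>u\<close> vanished, polarising once more and using non-degeneracy would make every vector a
  multiple of \<open>u\<close>, against dimension at least two.\<close>

lemma nondegenerate_plane:
  fixes b :: "'a::euclidean_space bilin"
  assumes b: "metric_at b" and dim: "DIM('a) \<ge> 2"
  shows "\<exists>u v. b u u * b v v - (b u v)\<^sup>2 \<noteq> 0"
proof -
  note bil = metric_atD(1)[OF b] and sym = metric_atD(2)[OF b] and nd = metric_atD(3)[OF b]
  note simps = bilinear_ladd[OF bil] bilinear_lmul[OF bil] bilinear_lsub[OF bil]
  obtain u where u: "b u u \<noteq> 0"
  proof -
    have "\<exists>u. b u u \<noteq> 0"
    proof (rule ccontr)
      assume "\<not> ?thesis"
      then have "b u v = 0" for u v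
        using symmetric_form_zero[of b] sym simps by metis
      then have "u = 0" for u using nd by blast
      then show False using dim by (metis nonempty_Basis nonzero_Basis ex_in_conv)
    qed
    then show ?thesis using that by blast
  qed
  show ?thesis
  proof (rule ccontr)
    assume neg: "\<not> ?thesis"
    have "b v w * b u u - b u v * b u w = 0" for v w
    proof (rule symmetric_form_zero[where b = "\<lambda>v w. b v w * b u u - b u v * b u w"])
      show "b (v + v') w * b u u - b u (v + v') * b u w
          = b v w * b u u - b u v * b u w + (b v' w * b u u - b u v' * b u w)" for v v' w
        by (simp add: simps bilinear_radd[OF bil] algebra_simps)
      show "b v w * b u u - b u v * b u w = b w v * b u u - b u w * b u v" for v w
        using sym[of v w] by simp
      show "b v v * b u u - b u v * b u v = 0" for v
      proof -
        have "b u u * b v v - (b u v)\<^sup>2 = 0" using neg by blast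
        then show ?thesis by (simp add: power2_eq_square mult.commute)
      qed
    qed
    then have "b (b u u *\<^sub>R v - b u v *\<^sub>R u) w = 0" for v w
      unfolding simps real_scaleR_def mult.commute[of "b u u"] .
    then have "b u u *\<^sub>R v - b u v *\<^sub>R u = 0" for v using nd by blast
    then have "v = (b u v / b u u) *\<^sub>R u" for v
      using u by (metis divide_inverse_commute eq_iff_diff_eq_0 scaleR_scaleR scaleR_one left_inverse)
    then have "UNIV \<subseteq> span {u}" by (metis span_base span_scale singletonI subsetI)
    then have "DIM('a) \<le> card {u}" by (metis dim_le_card dim_UNIV finite.emptyI finite_insert)
    then show False using dim by simp
  qed
qed

text \<open>Non-degenerate planes are dense: along a line through \<open>(u, v)\<close> in the direction of a
  non-degenerate pair the discriminant is a non-zero polynomial.\<close>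

lemma curvature_like_zero_nondegenerate:
  fixes b :: "'a::euclidean_space bilin"
  assumes b: "metric_at b" and dim: "DIM('a) \<ge> 2" and T: "curvature_like T"
    and sec: "\<And>u v. b u u * b v v - (b u v)\<^sup>2 \<noteq> 0 \<Longrightarrow> T u v v u = 0"
  shows "T u v w z = 0"
proof (rule curvature_like_zero[OF T])
  fix u v
  obtain p q where pq: "b p p * b q q - (b p q)\<^sup>2 \<noteq> 0" using nondegenerate_plane[OF b dim] by blast
  note bil = metric_atD(1)[OF b] and sym = metric_atD(2)[OF b]
  note lin = curvature_likeD(1,2)[OF T] curvature_like_linear[OF T]
    bilinear_ladd[OF bil] bilinear_lmul[OF bil] bilinear_radd[OF bil] bilinear_rmul[OF bil]
  \<comment> \<open>\<open>P\<close> and \<open>D\<close> are the curvature value and the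
    discriminant along the line, as polynomials in its parameter. The constant coefficient of
    \<open>P\<close> is the value to be shown zero; the coefficient of \<open>D\<close> in degree
    four is the discriminant of \<open>p\<close> and \<open>q\<close>.\<close>
  define P where "P = [:T u v v u, T p v v u + T u q v u + T u v q u + T u v v p,
    T p q v u + T p v q u + T p v v p + T u q q u + T u q v p + T u v q p,
    T p q q u + T p q v p + T p v q p + T u q q p, T p q q p:]"
  define D where "D = [:b u u, 2 * b u p, b p p:] * [:b v v, 2 * b v q, b q q:]
    - [:b u v, b u q + b p v, b p q:]\<^sup>2"
  have P: "poly P t = T (u + t *\<^sub>R p) (v + t *\<^sub>R q) (v + t *\<^sub>R q) (u + t *\<^sub>R p)" for t
    by (simp add: P_def lin algebra_simps)
  have D: "poly D t = b (u + t *\<^sub>R p) (u + t *\<^sub>R p) * b (v + t *\<^sub>R q) (v + t *\<^sub>R q)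
      - (b (u + t *\<^sub>R p) (v + t *\<^sub>R q))\<^sup>2" for t
    using sym[of p u] sym[of q v] by (simp add: D_def lin algebra_simps)
  have "poly (P * D) t = 0" for t
    using sec[of "u + t *\<^sub>R p" "v + t *\<^sub>R q"] by (auto simp: P D)
  then have "P * D = 0" using poly_all_0_iff_0 by blast
  moreover have "coeff D 4 = b p p * b q q - (b p q)\<^sup>2"
    by (simp add: D_def power2_eq_square numeral_eq_Suc)
  then have "D \<noteq> 0" using pq by auto
  ultimately have "P = 0" by simp
  then show "T u v v u = 0" by (simp add: P_def)
qed

section \<open>Symmetries of the Riemann tensor\<close>

context chart_metric
begin

lemma cov_along_const: "cov_along G (\<lambda>y. y) v (\<lambda>_. w) y = \<Gamma> y v w"
  by (simp add: cov_along_def)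

text \<open>The iterated derivative of the constant field \<open>w\<close>, first in direction
  \<open>v\<close> and then in direction \<open>u\<close>.\<close>

definition cov2 :: "real^'n \<Rightarrow> real^'n \<Rightarrow> real^'n \<Rightarrow> real^'n \<Rightarrow> real^'n" where
  "cov2 x u v w = cov_along G (\<lambda>y. y) u (\<lambda>y. \<Gamma> y v w) x"

lemma curv_cov2:
  assumes "x \<in> U"
  shows "curv G x u v w = cov2 x u v w - cov2 x v u w"
  using bilinear_lzero[OF christoffel_bilinear[OF assms]] by (simp add: curv_eq cov2_def)

text \<open>This is vanishing torsion, differentiated once; it makes the six terms of the first
  Bianchi identity cancel in pairs.\<close>

lemma cov2_sym: "x \<in> U \<Longrightarrow> cov2 x u v w = cov2 x u w v"
  unfolding cov2_def by (rule cov_along_cong_open[OF open_dom]) (auto simp: christoffel_sym)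

lemma linear_cov2_1:
  assumes "x \<in> U"
  shows "linear (\<lambda>u. cov2 x u v w)"
  unfolding cov2_def cov_along_def
  by (rule linearI)
     (simp_all add: linear_add[OF has_derivative_imp_linear_frechet[OF christoffel_differentiable[OF assms]]]
        linear_scale[OF has_derivative_imp_linear_frechet[OF christoffel_differentiable[OF assms]]]
        bilinear_ladd[OF christoffel_bilinear[OF assms]] bilinear_lmul[OF christoffel_bilinear[OF assms]]
        algebra_simps)

lemma linear_cov2_2:
  assumes x: "x \<in> U"
  shows "linear (\<lambda>v. cov2 x u v w)"
proof (rule linearI)
  note \<Gamma>_simps = bilinear_ladd[OF christoffel_bilinear] bilinear_lmul[OF christoffel_bilinear]
    bilinear_radd[OF christoffel_bilinear] bilinear_rmul[OF christoffel_bilinear]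
  show "cov2 x u (v + v') w = cov2 x u v w + cov2 x u v' w" for v v'
  proof -
    have "((\<lambda>y. \<Gamma> y (v + v') w) has_derivative
        (\<lambda>d. frechet_derivative (\<lambda>y. \<Gamma> y v w) (at x) d + frechet_derivative (\<lambda>y. \<Gamma> y v' w) (at x) d)) (at x)"
      by (rule has_derivative_transform_within_open[OF _ open_dom x])
         (auto intro!: has_derivative_add has_derivative_frechet christoffel_differentiable x simp: \<Gamma>_simps)
    from frechet_eqI[OF this] show ?thesis by (simp add: cov2_def cov_along_def \<Gamma>_simps x)
  qed
  show "cov2 x u (c *\<^sub>R v) w = c *\<^sub>R cov2 x u v w" for c v
  proof -
    have "((\<lambda>y. \<Gamma> y (c *\<^sub>R v) w) has_derivative
        (\<lambda>d. c *\<^sub>R frechet_derivative (\<lambda>y. \<Gamma> y v w) (at x) d)) (at x)"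
      by (rule has_derivative_transform_within_open[OF _ open_dom x])
         (auto intro!: has_derivative_scaleR_right has_derivative_frechet christoffel_differentiable x simp: \<Gamma>_simps)
    from frechet_eqI[OF this] show ?thesis by (simp add: cov2_def cov_along_def \<Gamma>_simps x algebra_simps)
  qed
qed

text \<open>Differentiate \<open>G y w z\<close> twice with the compatible connection. The products
  of first derivatives are symmetric in \<open>u\<close> and \<open>v\<close>, so symmetry of second
  derivatives leaves only the two curvature terms.\<close>

lemma riem_antisym_34:
  assumes x: "x \<in> U"
  shows "riem G x u v w z = - riem G x u v z w"
proof -
  have dd: "frechet_derivative (\<lambda>y. dG y v w z) (at x) u =
      G x (cov2 x u v w) z + G x (\<Gamma> x v w) (\<Gamma> x u z) + (G x (\<Gamma> x u w) (\<Gamma> x v z) + G x w (cov2 x u v z))" for u v w z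
  proof -
    have d: "((\<lambda>y. G y (\<Gamma> y v w) z + G y w (\<Gamma> y v z)) has_derivative
      (\<lambda>u. (G x (cov2 x u v w) z + G x (\<Gamma> x v w) (\<Gamma> x u z))
         + (G x (\<Gamma> x u w) (\<Gamma> x v z) + G x w (cov2 x u v z)))) (at x)"
      using has_derivative_metric_along[OF open_dom x, of "\<lambda>y. y" "\<lambda>y. \<Gamma> y v w" "\<lambda>_. z"]
        has_derivative_metric_along[OF open_dom x, of "\<lambda>y. y" "\<lambda>_. w" "\<lambda>y. \<Gamma> y v z"]
      by (intro has_derivative_add)
         (simp_all add: cov_along_const cov2_def christoffel_differentiable x)
    have "((\<lambda>y. dG y v w z) has_derivative
      (\<lambda>u. (G x (cov2 x u v w) z + G x (\<Gamma> x v w) (\<Gamma> x u z))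
         + (G x (\<Gamma> x u w) (\<Gamma> x v z) + G x w (cov2 x u v z)))) (at x)"
      by (rule has_derivative_transform_within_open[OF d open_dom x]) (simp add: christoffel_compat)
    from frechet_eqI[OF this] show ?thesis .
  qed
  show ?thesis
    using second_derivative_symmetric[OF smooth[of w z] open_dom x, of u v]
    unfolding dd riem_def lower_def curv_cov2[OF x] G_simps[OF x]
    using G_sym[OF x, of w] G_sym[OF x, of z] by simp
qed

lemma curvature_like_riem:
  assumes x: "x \<in> U"
  shows "curvature_like (riem G x)"
  unfolding curvature_like_def
proof (intro conjI allI)
  show "linear (\<lambda>u. riem G x u v w z)" for v w z
    by (rule linearI)
       (simp_all add: riem_def lower_def curv_cov2[OF x] G_simps[OF x]
          linear_add[OF linear_cov2_1[OF x]] linear_scale[OF linear_cov2_1[OF x]]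
          linear_add[OF linear_cov2_2[OF x]] linear_scale[OF linear_cov2_2[OF x]] algebra_simps)
  show "riem G x u v w z = - riem G x v u w z" for u v w z
    by (simp add: riem_def lower_def curv_cov2[OF x] G_simps[OF x])
  show "riem G x u v w z = - riem G x u v z w" for u v w z
    by (rule riem_antisym_34[OF x])
  show "riem G x u v w z + riem G x v w u z + riem G x w u v z = 0" for u v w z
    using cov2_sym[OF x, of u v w] cov2_sym[OF x, of v w u] cov2_sym[OF x, of w u v]
    by (simp add: riem_def lower_def curv_cov2[OF x] G_simps[OF x])
qed

text \<open>The sectional condition speaks only of non-degenerate planes; the difference of both
  sides is curvature-like and vanishes on these, which is enough.\<close>

lemma riem_constant_curvature:
  assumes x: "x \<in> U" and dim: "CARD('n) \<ge> 2"
    and k: "\<And>u v. G x u u * G x v v - (G x u v)\<^sup>2 \<noteq> 0 \<Longrightarrow>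
      riem G x u v v u / (G x u u * G x v v - (G x u v)\<^sup>2) = k"
  shows "riem G x u v w z = k * const_curv_tensor (G x) u v w z"
proof -
  have "riem G x u v w z - k * const_curv_tensor (G x) u v w z = 0"
  proof (rule curvature_like_zero_nondegenerate[OF metric[OF x],
        where T = "\<lambda>u v w z. riem G x u v w z - k * const_curv_tensor (G x) u v w z"])
    show "curvature_like (\<lambda>u v w z. riem G x u v w z - k * const_curv_tensor (G x) u v w z)"
      using curvature_like_diff_scale[OF curvature_like_riem[OF x]
          curvature_like_const_curv_tensor[OF G_bilinear[OF x] G_sym[OF x]]] by simp
    show "riem G x u v v u - k * const_curv_tensor (G x) u v v u = 0"
      if "G x u u * G x v v - (G x u v)\<^sup>2 \<noteq> 0" for u v
      using k[OF that] that G_sym[OF x, of v u]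
      by (simp add: const_curv_tensor_def field_simps power2_eq_square)
  qed (use dim in simp)
  then show ?thesis by simp
qed

end

text \<open>The two dimensions are independent, so that the locale serves both the immersion of the
  hypersurface and the transition maps between its charts.\<close>

locale isometric_chart_map = M: chart_metric g V + N: chart_metric h U
  for g :: "real^'n \<Rightarrow> (real^'n) bilin" and V and h :: "real^'m \<Rightarrow> (real^'m) bilin" and U +
  fixes F :: "real^'n \<Rightarrow> real^'m"
  assumes F: "smooth_on F V" and F_into: "F ` V \<subseteq> U"
    and isometric: "x \<in> V \<Longrightarrow>
      g x u v = h (F x) (frechet_derivative F (at x) u) (frechet_derivative F (at x) v)"
begin

abbreviation dF :: "real^'n \<Rightarrow> real^'n \<Rightarrow> real^'m" where
  "dF x u \<equiv> frechet_derivative F (at x) u"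

lemma FU: "x \<in> V \<Longrightarrow> F x \<in> U"
  using F_into by blast

lemma dF_smooth: "smooth_on (\<lambda>y. dF y v) V"
  by (rule smooth_on_frechet_derivative[OF F])

lemma linear_dF: "x \<in> V \<Longrightarrow> linear (\<lambda>u. dF x u)"
  by (rule has_derivative_imp_linear_frechet[OF smooth_onD[OF F]])

lemma cov_along_dF_sym:
  assumes x: "x \<in> V"
  shows "cov_along h F u (\<lambda>y. dF y v) x = cov_along h F v (\<lambda>y. dF y u) x"
  using second_derivative_symmetric[OF F M.open_dom x, of u v] N.christoffel_sym[OF FU[OF x], of "dF x u"]
  by (simp add: cov_along_def)

text \<open>Both sides are symmetric in \<open>u\<close> and \<open>v\<close>, and by isometry their
  symmetrisations in the last two slots are the same derivative of \<open>g\<close>;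
  \<open>koszul_unique\<close> then applies.\<close>

lemma tangential_cov_along:
  assumes x: "x \<in> V"
  shows "h (F x) (cov_along h F u (\<lambda>y. dF y v) x) (dF x z) = g x (M.\<Gamma> x u v) z"
proof (rule koszul_unique[where T = "\<lambda>u v z. h (F x) (cov_along h F u (\<lambda>y. dF y v) x) (dF x z)"
      and T' = "\<lambda>u v z. g x (M.\<Gamma> x u v) z"])
  show "h (F x) (cov_along h F u (\<lambda>y. dF y v) x) (dF x z) = h (F x) (cov_along h F v (\<lambda>y. dF y u) x) (dF x z)" for u v z
    by (simp only: cov_along_dF_sym[OF x, of u v])
  show "g x (M.\<Gamma> x u v) z = g x (M.\<Gamma> x v u) z" for u v z
    by (simp only: M.christoffel_sym[OF x, of u v])
  fix u v z
  have "M.dG x u v z = h (F x) (cov_along h F u (\<lambda>y. dF y v) x) (dF x z) + h (F x) (dF x v) (cov_along h F u (\<lambda>y. dF y z) x)"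
  proof (rule frechet_eqI)
    show "((\<lambda>y. g y v z) has_derivative (\<lambda>u. h (F x) (cov_along h F u (\<lambda>y. dF y v) x) (dF x z)
        + h (F x) (dF x v) (cov_along h F u (\<lambda>y. dF y z) x))) (at x)"
      by (rule has_derivative_transform_within_open[OF N.has_derivative_metric_along[OF M.open_dom x F_into]
            M.open_dom x])
         (simp_all add: smooth_onD[OF F x] smooth_onD[OF dF_smooth x] isometric)
  qed
  then show "h (F x) (cov_along h F u (\<lambda>y. dF y v) x) (dF x z) + h (F x) (cov_along h F u (\<lambda>y. dF y z) x) (dF x v)
      = g x (M.\<Gamma> x u v) z + g x (M.\<Gamma> x u z) v"
    using M.christoffel_compat[OF x, of v z u] N.G_sym[OF FU[OF x], of "dF x v"] M.G_sym[OF x, of v] by simp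
qed

text \<open>The normal-valued second fundamental form, obtained from the Gauss formula without
  choosing a unit normal.\<close>

definition sff :: "real^'n \<Rightarrow> real^'n \<Rightarrow> real^'n \<Rightarrow> real^'m" where
  "sff x u v = cov_along h F u (\<lambda>y. dF y v) x - dF x (M.\<Gamma> x u v)"

lemma sff_normal:
  assumes x: "x \<in> V"
  shows "h (F x) (sff x u v) (dF x z) = 0"
  unfolding sff_def N.G_simps[OF FU[OF x]] tangential_cov_along[OF x] isometric[OF x] by simp

theorem gauss_equation:
  assumes x: "x \<in> V"
  shows "riem h (F x) (dF x u) (dF x v) (dF x w) (dF x z) =
    riem g x u v w z - h (F x) (sff x v w) (sff x u z) + h (F x) (sff x u w) (sff x v z)"
proof -
  note hs = N.G_simps[OF FU[OF x]]
  have normal': "h (F x) (dF x z) (sff x u v) = 0" for u v z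
    using sff_normal[OF x] N.G_sym[OF FU[OF x]] by metis
  \<comment> \<open>Tangential and normal parts are orthogonal, and the tangential parts are
    measured by \<open>g\<close>.\<close>
  have split: "h (F x) (cov_along h F v (\<lambda>y. dF y w) x) (cov_along h F u (\<lambda>y. dF y z) x) =
    g x (M.\<Gamma> x v w) (M.\<Gamma> x u z) + h (F x) (sff x v w) (sff x u z)" for u v w z
  proof -
    have "cov_along h F v (\<lambda>y. dF y w) x = dF x (M.\<Gamma> x v w) + sff x v w" for v w
      by (simp add: sff_def)
    then show ?thesis by (simp add: hs sff_normal[OF x] normal' isometric[OF x])
  qed
  have diff: "(\<lambda>y. cov_along h F v (\<lambda>y. dF y w) y) differentiable (at x)" for v w
    using N.cov_along_derivative[OF M.open_dom x F_into F dF_smooth] unfolding differentiable_def by blast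
  \<comment> \<open>The function \<open>g y (M.\<Gamma> y v w) z\<close> is differentiated once in
    the ambient space (\<open>d1\<close>) and once intrinsically (\<open>d2\<close>); uniqueness of
    the derivative equates the results.\<close>
  have key: "h (F x) (cov_along h F u (cov_along h F v (\<lambda>y. dF y w)) x) (dF x z) =
    g x (M.cov2 x u v w) z - h (F x) (sff x v w) (sff x u z)" for u v w z
  proof -
    have d1: "((\<lambda>y. g y (M.\<Gamma> y v w) z) has_derivative
        (\<lambda>u. h (F x) (cov_along h F u (cov_along h F v (\<lambda>y. dF y w)) x) (dF x z)
          + h (F x) (cov_along h F v (\<lambda>y. dF y w) x) (cov_along h F u (\<lambda>y. dF y z) x))) (at x)"
      by (rule has_derivative_transform_within_open[OF N.has_derivative_metric_along[OF M.open_dom x F_into]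
            M.open_dom x])
         (simp_all add: smooth_onD[OF F x] smooth_onD[OF dF_smooth x] diff tangential_cov_along)
    have d2: "((\<lambda>y. g y (M.\<Gamma> y v w) z) has_derivative
        (\<lambda>u. g x (M.cov2 x u v w) z + g x (M.\<Gamma> x v w) (M.\<Gamma> x u z))) (at x)"
      using M.has_derivative_metric_along[OF M.open_dom x, of "\<lambda>y. y" "\<lambda>y. M.\<Gamma> y v w" "\<lambda>_. z"]
      by (simp add: M.cov_along_const M.cov2_def M.christoffel_differentiable x)
    from fun_cong[OF has_derivative_unique[OF d1 d2], of u]
    have "h (F x) (cov_along h F u (cov_along h F v (\<lambda>y. dF y w)) x) (dF x z)
          + h (F x) (cov_along h F v (\<lambda>y. dF y w) x) (cov_along h F u (\<lambda>y. dF y z) x)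
        = g x (M.cov2 x u v w) z + g x (M.\<Gamma> x v w) (M.\<Gamma> x u z)"
      .
    then show ?thesis using split by simp
  qed
  have "riem h (F x) (dF x u) (dF x v) (dF x w) (dF x z) =
    h (F x) (cov_along h F u (cov_along h F v (\<lambda>y. dF y w)) x - cov_along h F v (cov_along h F u (\<lambda>y. dF y w)) x) (dF x z)"
    unfolding riem_def lower_def N.curv_along[OF M.open_dom x F_into F dF_smooth] ..
  then show ?thesis
    unfolding hs key by (simp add: riem_def lower_def M.curv_cov2[OF x] M.G_simps[OF x])
qed

end

section \<open>Hypersurfaces and forms of rank two\<close>

lemma trace_rank_one: "trace (matrix (\<lambda>Z::real^'n. l Z *\<^sub>R V)) = l V" if "linear l"
proof -
  have "l V = l (\<Sum>i\<in>UNIV. V $ i *\<^sub>R axis i 1)"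
    using basis_expansion[of V] by (simp add: scalar_mult_eq_scaleR)
  then show ?thesis
    by (simp add: linear_sum[OF that] linear_scale[OF that] trace_def matrix_def mult.commute)
qed

lemma trace_matrix_add: "trace (matrix (\<lambda>Z. f Z + g Z)) = trace (matrix f) + trace (matrix g)"
  and trace_matrix_diff: "trace (matrix (\<lambda>Z. f Z - g Z)) = trace (matrix f) - trace (matrix g)"
  and trace_matrix_scaleR: "trace (matrix (\<lambda>Z. c *\<^sub>R f Z)) = c * trace (matrix f)"
  and trace_matrix_ident: "trace (matrix (\<lambda>Z::real^'n. Z)) = real CARD('n)"
  for f g :: "real^'n \<Rightarrow> real^'n"
  by (simp_all add: trace_def matrix_def sum.distrib sum_subtractf sum_distrib_left)

lemma trace_matrix_conj:
  fixes \<phi> :: "real^'n \<Rightarrow> real^'m" and \<psi> :: "real^'m \<Rightarrow> real^'n" and f :: "real^'m \<Rightarrow> real^'m"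
  assumes "linear \<phi>" "linear \<psi>" "linear f" "\<And>u. \<phi> (\<psi> u) = u"
  shows "trace (matrix (\<lambda>u. \<psi> (f (\<phi> u)))) = trace (matrix f)"
proof -
  have "matrix (\<psi> \<circ> (f \<circ> \<phi>)) = matrix \<psi> ** (matrix f ** matrix \<phi>)"
    by (simp add: matrix_compose assms linear_compose)
  then have "trace (matrix (\<psi> \<circ> (f \<circ> \<phi>))) = trace (matrix f ** matrix \<phi> ** matrix \<psi>)"
    using trace_mul_sym[of "matrix \<psi>"] by simp
  also have "matrix f ** matrix \<phi> ** matrix \<psi> = matrix (f \<circ> (\<phi> \<circ> \<psi>))"
    by (simp add: matrix_compose assms linear_compose matrix_mul_assoc)
  also have "f \<circ> (\<phi> \<circ> \<psi>) = f" using assms(4) by auto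
  finally show ?thesis by (simp add: o_def)
qed

text \<open>\<open>W\<close> is a basis of the range of the Gram matrix, so its size is the rank,
  and the \<open>c w\<close> are the coordinates of \<open>gram B *v v\<close>. The inclusion of
  \<open>W\<close> in the range is kept for \<open>rank_two_form\<close>, where symmetry is
  exploited through it.\<close>

lemma bilin_rank_decomposition:
  assumes B: "bilinear B"
  shows "\<exists>W c. card W = bilin_rank B \<and> W \<subseteq> range (\<lambda>v. gram B *v v) \<and>
    (\<forall>w. linear (c w)) \<and> (\<forall>u v. B u v = (\<Sum>w\<in>W. (u \<bullet> w) * c w v))"
proof -
  have r: "bilin_rank B = dim (range (\<lambda>v. gram B *v v))"
    by (simp add: bilin_rank_def gram_def rank_dim_range)
  obtain W where W: "W \<subseteq> range (\<lambda>v. gram B *v v)" "independent W"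
    "range (\<lambda>v. gram B *v v) \<subseteq> span W" "card W = dim (range (\<lambda>v. gram B *v v))"
    using basis_exists by blast
  have fin: "finite W" using W(2) independent_imp_finite by blast
  have in_span: "gram B *v v \<in> span W" for v using W(3) by blast
  show ?thesis
  proof (intro exI conjI allI)
    show "linear (\<lambda>v. representation W (gram B *v v) w)" for w
      by (rule linearI)
         (simp_all add: matrix_vector_right_distrib matrix_vector_mult_scaleR
            real_vector.representation_add[OF W(2) in_span in_span]
            real_vector.representation_scale[OF W(2) in_span])
    show "B u v = (\<Sum>w\<in>W. (u \<bullet> w) * representation W (gram B *v v) w)" for u v
    proof -
      have "gram B *v v = (\<Sum>w\<in>W. representation W (gram B *v v) w *\<^sub>R w)"
        by (rule real_vector.sum_representation_eq[OF W(2) in_span fin order_refl, symmetric])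
      then have "u \<bullet> (gram B *v v) = (\<Sum>w\<in>W. representation W (gram B *v v) w * (u \<bullet> w))"
        by (metis (no_types, lifting) inner_sum_right inner_scaleR_right sum.cong)
      then show ?thesis by (simp add: bilinear_gram[OF B] mult.commute)
    qed
  qed (use W r in auto)
qed

lemma rank_one_form:
  assumes B: "bilinear B" and r: "bilin_rank B = 1"
  obtains s t where "linear s" "linear t" "\<And>u v. B u v = s u * t v"
proof -
  obtain W c where W: "card W = bilin_rank B" "W \<subseteq> range (\<lambda>v. gram B *v v)"
    "\<forall>w. linear (c w)" "\<forall>u v. B u v = (\<Sum>w\<in>W. (u \<bullet> w) * c w v)"
    using bilin_rank_decomposition[OF B] by blast
  obtain w where "W = {w}" using W(1) r card_1_singletonE by metis
  then have "B u v = (u \<bullet> w) * c w v" for u v using W(4) by simp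
  moreover have "linear (\<lambda>u. u \<bullet> w)" by (simp add: linear_iff inner_add_left)
  ultimately show thesis using that W(3) by blast
qed

text \<open>Since \<open>w1\<close> and \<open>w2\<close> lie in the range of the Gram matrix,
  symmetry rewrites the functionals paired with them through \<open>c w1\<close> and
  \<open>c w2\<close>. Thus \<open>B\<close> is a quadratic expression in two functionals, and its
  minors are multiples of the square of their 2-form.\<close>

lemma rank_two_form:
  assumes B: "bilinear B" and sym: "\<And>u v. B u v = B v u" and r: "bilin_rank B = 2"
  obtains p q d where "linear p" "linear q"
    "\<And>u v w z. B u z * B v w - B u w * B v z = d * (p u * q v - q u * p v) * (p w * q z - q w * p z)"
proof -
  obtain W c where W: "card W = bilin_rank B" "W \<subseteq> range (\<lambda>v. gram B *v v)"
    "\<forall>w. linear (c w)" "\<forall>u v. B u v = (\<Sum>w\<in>W. (u \<bullet> w) * c w v)"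
    using bilin_rank_decomposition[OF B] by blast
  obtain w1 w2 where w: "W = {w1, w2}" "w1 \<noteq> w2" using W(1) r card_2_iff by metis
  have B_eq: "B u v = (u \<bullet> w1) * c w1 v + (u \<bullet> w2) * c w2 v" for u v using W(4) w by simp
  obtain c1 c2 where c: "w1 = gram B *v c1" "w2 = gram B *v c2" using W(2) w by blast
  have P: "u \<bullet> w1 = (c1 \<bullet> w1) * c w1 u + (c1 \<bullet> w2) * c w2 u" for u
    using B_eq[of c1 u] sym[of u c1] by (simp add: c bilinear_gram[OF B, symmetric])
  have Q: "u \<bullet> w2 = (c2 \<bullet> w1) * c w1 u + (c2 \<bullet> w2) * c w2 u" for u
    using B_eq[of c2 u] sym[of u c2] by (simp add: c bilinear_gram[OF B, symmetric])
  \<comment> \<open>The determinant of the coefficient matrix of \<open>B\<close> in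
    \<open>c w1\<close> and \<open>c w2\<close>; the order of the last two arguments brings in the
    sign of \<open>- d\<close>.\<close>
  define d where "d = (c1 \<bullet> w1) * (c2 \<bullet> w2) - (c1 \<bullet> w2) * (c2 \<bullet> w1)"
  have "B u z * B v w - B u w * B v z = (- d) * (c w1 u * c w2 v - c w2 u * c w1 v) * (c w1 w * c w2 z - c w2 w * c w1 z)" for u v w z
    unfolding B_eq P[of u] P[of v] Q[of u] Q[of v] d_def by algebra
  then show thesis using that W(3) by blast
qed

section \<open>The Ricci tensor and the Ricci operator\<close>

context chart_metric
begin

lemma linear_curv:
  assumes x: "x \<in> U"
  shows "linear (\<lambda>u. curv G x u v w)" "linear (\<lambda>v. curv G x u v w)" "linear (\<lambda>w. curv G x u v w)"
proof -
  note lin = linear_add[OF linear_cov2_1[OF x]] linear_scale[OF linear_cov2_1[OF x]]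
    linear_add[OF linear_cov2_2[OF x]] linear_scale[OF linear_cov2_2[OF x]]
  show "linear (\<lambda>u. curv G x u v w)" "linear (\<lambda>v. curv G x u v w)"
    by (auto intro!: linearI simp: curv_cov2[OF x] lin algebra_simps)
  show "linear (\<lambda>w. curv G x u v w)"
    by (auto intro!: linearI simp: curv_cov2[OF x] cov2_sym[OF x, of _ _ "_ + _"]
        cov2_sym[OF x, of _ _ "_ *\<^sub>R _"] lin algebra_simps)
       (auto simp: cov2_sym[OF x, of u v] cov2_sym[OF x, of v u] algebra_simps)
qed

lemma linear_ricci:
  assumes x: "x \<in> U"
  shows "linear (\<lambda>u. ricci G x u v)" "linear (\<lambda>v. ricci G x u v)"
  unfolding ricci_def
  by (auto intro!: linearI simp: linear_add[OF linear_curv(2)[OF x]] linear_scale[OF linear_curv(2)[OF x]]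
      linear_add[OF linear_curv(3)[OF x]] linear_scale[OF linear_curv(3)[OF x]]
      trace_matrix_add trace_matrix_scaleR)

lemma ricci_op_works:
  assumes x: "x \<in> U"
  shows "G x (ricci_op G x X) Y = ricci G x X Y"
  unfolding ricci_op_def using theI'[OF metric_riesz[OF metric[OF x] linear_ricci(2)[OF x]]] by blast

lemma ricci_op_eqI:
  assumes x: "x \<in> U" and "\<And>Y. G x W Y = ricci G x X Y"
  shows "ricci_op G x X = W"
  by (rule metric_at_eqI[OF metric[OF x]]) (simp add: ricci_op_works[OF x] assms(2))

lemma linear_ricci_op:
  assumes x: "x \<in> U"
  shows "linear (ricci_op G x)"
  by (rule linearI; rule ricci_op_eqI[OF x])
     (simp_all add: G_simps[OF x] ricci_op_works[OF x] linear_add[OF linear_ricci(1)[OF x]]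
        linear_scale[OF linear_ricci(1)[OF x]])

end

section \<open>Isometry invariance of the scalar curvature, and hypersurfaces\<close>

context isometric_chart_map
begin

lemma inj_dF:
  assumes x: "x \<in> V"
  shows "inj (dF x)"
proof -
  have "u = 0" if "dF x u = 0" for u
    using metric_atD(3)[OF M.metric[OF x], of u] isometric[OF x, of u] that
    by (simp add: N.G_simps[OF FU[OF x]])
  then show ?thesis using linear_injective_0[OF linear_dF[OF x]] by simp
qed

text \<open>In equal dimensions \<open>dF x\<close> is bijective, so nothing is normal to its range
  and \<open>sff\<close> vanishes. The Gauss equation then says that \<open>dF x\<close> intertwines
  the curvatures, and traces are invariant under conjugation.\<close>

lemma scalar_curv_isometric:
  assumes x: "x \<in> V" and dim: "CARD('n) = CARD('m)"
  shows "scalar_curv g x = scalar_curv h (F x)"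
proof -
  note y = FU[OF x] and lin = linear_dF[OF x]
  have surj: "surj (dF x)"
    by (rule linear_injective_imp_surjective[OF lin inj_dF[OF x]]) (use dim in \<open>simp add: dim_UNIV\<close>)
  have sff: "sff x u v = 0" for u v
  proof (rule metric_atD(3)[OF N.metric[OF y]])
    show "h (F x) (sff x u v) w = 0" for w
      using sff_normal[OF x, of u v] surj by (metis surjD)
  qed
  obtain \<psi> where \<psi>: "linear \<psi>" "\<psi> \<circ> dF x = id"
    using linear_injective_left_inverse[OF lin inj_dF[OF x]] by blast
  have \<psi>1: "\<psi> (dF x u) = u" for u using \<psi>(2) by (metis comp_apply id_apply)
  have \<psi>2: "dF x (\<psi> u) = u" for u using surj \<psi>1 by (metis surjD)
  have curv: "dF x (curv g x u v w) = curv h (F x) (dF x u) (dF x v) (dF x w)" for u v w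
  proof (rule metric_at_eqI[OF N.metric[OF y]])
    fix z
    have "h (F x) (dF x (curv g x u v w)) (dF x (\<psi> z)) = h (F x) (curv h (F x) (dF x u) (dF x v) (dF x w)) (dF x (\<psi> z))"
      using gauss_equation[OF x, of u v w "\<psi> z"]
      by (simp add: riem_def lower_def isometric[OF x] sff N.G_simps[OF y])
    then show "h (F x) (dF x (curv g x u v w)) z = h (F x) (curv h (F x) (dF x u) (dF x v) (dF x w)) z"
      by (simp add: \<psi>2)
  qed
  have tr: "trace (matrix f) = trace (matrix f')" if f: "linear f'" "\<And>u. dF x (f u) = f' (dF x u)"
    for f :: "real^'n \<Rightarrow> real^'n" and f' :: "real^'m \<Rightarrow> real^'m"
  proof -
    have "f u = \<psi> (f' (dF x u))" for u using f(2) \<psi>1 by metis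
    then have "f = (\<lambda>u. \<psi> (f' (dF x u)))" by blast
    then show ?thesis using trace_matrix_conj[OF lin \<psi>(1) f(1) \<psi>2] by simp
  qed
  have ricci: "ricci g x u v = ricci h (F x) (dF x u) (dF x v)" for u v
    unfolding ricci_def by (rule tr[OF N.linear_curv(1)[OF y] curv])
  have "dF x (ricci_op g x u) = ricci_op h (F x) (dF x u)" for u
  proof (rule N.ricci_op_eqI[OF y, symmetric])
    fix z
    have "h (F x) (dF x (ricci_op g x u)) (dF x (\<psi> z)) = ricci h (F x) (dF x u) (dF x (\<psi> z))"
      by (simp add: isometric[OF x, symmetric] M.ricci_op_works[OF x] ricci)
    then show "h (F x) (dF x (ricci_op g x u)) z = ricci h (F x) (dF x u) z" by (simp add: \<psi>2)
  qed
  then show ?thesis unfolding scalar_curv_def by (rule tr[OF N.linear_ricci_op[OF y]])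
qed

lemma second_fund_cov_along: "second_fund h F \<xi> x u v = h (F x) (cov_along h F u (\<lambda>y. dF y v) x) \<xi>"
  by (simp add: second_fund_def cov_along_def)

lemma second_fund_sym: "x \<in> V \<Longrightarrow> second_fund h F \<xi> x u v = second_fund h F \<xi> x v u"
  by (simp only: second_fund_cov_along cov_along_dF_sym[of x u v])

lemma bilinear_second_fund:
  assumes x: "x \<in> V"
  shows "bilinear (second_fund h F \<xi> x)"
proof -
  have "linear (\<lambda>u. second_fund h F \<xi> x u v)" for v
    unfolding second_fund_cov_along cov_along_def
    by (rule linearI)
       (simp_all add: N.G_simps[OF FU[OF x]] linear_add[OF linear_dF[OF x]] linear_scale[OF linear_dF[OF x]]
         bilinear_ladd[OF N.christoffel_bilinear[OF FU[OF x]]] bilinear_lmul[OF N.christoffel_bilinear[OF FU[OF x]]]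
         linear_add[OF has_derivative_imp_linear_frechet[OF smooth_onD[OF dF_smooth x]]]
         linear_scale[OF has_derivative_imp_linear_frechet[OF smooth_onD[OF dF_smooth x]]] algebra_simps)
  moreover from this have "linear (\<lambda>v. second_fund h F \<xi> x u v)" for u
    by (simp only: second_fund_sym[OF x, of _ u])
  ultimately show ?thesis unfolding bilinear_def by blast
qed

text \<open>The vector \<open>\<xi>\<close> is not null, hence not tangential, and in codimension
  one it spans the space together with the range of \<open>dF x\<close>. Pairing with both shows
  that \<open>sff\<close> is \<epsilon> H times \<open>\<xi>\<close>; as \<epsilon> squares to 1,
  products of two values of \<open>sff\<close> keep a single factor \<epsilon>.\<close>

lemma hypersurface_gauss_equation:
  assumes x: "x \<in> V" and dim: "CARD('m) = CARD('n) + 1" and \<xi>: "unit_normal h F x \<xi>"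
  defines "H \<equiv> second_fund h F \<xi> x"
  shows "riem g x u v w z = riem h (F x) (dF x u) (dF x v) (dF x w) (dF x z)
    + h (F x) \<xi> \<xi> * (H u z * H v w - H u w * H v z)"
proof -
  note y = FU[OF x] note hs = N.G_simps[OF y]
  define \<epsilon> where "\<epsilon> = h (F x) \<xi> \<xi>"
  have \<epsilon>: "\<epsilon> * \<epsilon> = 1"
    using \<xi> unfolding unit_normal_def \<epsilon>_def by (metis abs_mult_self_eq mult_1)
  have nor: "h (F x) (dF x u) \<xi> = 0" "h (F x) \<xi> (dF x u) = 0" for u
    using \<xi> N.G_sym[OF y] unfolding unit_normal_def by metis+
  have "\<xi> \<notin> span (range (dF x))"
  proof
    assume "\<xi> \<in> span (range (dF x))"
    then have "\<xi> \<in> range (dF x)"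
      using linear_subspace_image[OF linear_dF[OF x] subspace_UNIV] span_eq_iff by blast
    then have "\<epsilon> = 0" using nor \<epsilon>_def by auto
    then show False using \<epsilon> by simp
  qed
  moreover have "dim (range (dF x)) = CARD('n)"
    using dim_image_eq[OF linear_dF[OF x], of UNIV] inj_dF[OF x] by (simp add: dim_UNIV)
  ultimately have "dim (insert \<xi> (range (dF x))) = CARD('m)" using dim by (simp add: dim_insert)
  then have span: "span (insert \<xi> (range (dF x))) = UNIV" by (simp add: dim_eq_full[symmetric])
  have sff: "sff x u v = (\<epsilon> * H u v) *\<^sub>R \<xi>" for u v
  proof -
    define W where "W = sff x u v - (\<epsilon> * H u v) *\<^sub>R \<xi>"
    have "h (F x) (sff x u v) \<xi> = H u v"
      by (simp add: sff_def hs nor H_def second_fund_cov_along)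
    then have "h (F x) W \<xi> = 0" using \<epsilon> by (simp add: W_def hs \<epsilon>_def[symmetric] algebra_simps)
    moreover have "h (F x) W (dF x z) = 0" for z by (simp add: W_def hs nor sff_normal[OF x])
    moreover have "subspace {Z. h (F x) W Z = 0}" by (simp add: subspace_def hs)
    ultimately have "span (insert \<xi> (range (dF x))) \<subseteq> {Z. h (F x) W Z = 0}"
      by (intro span_minimal) auto
    then have "W = 0" using span by (intro metric_atD(3)[OF N.metric[OF y]]) auto
    then show ?thesis by (simp add: W_def)
  qed
  have "h (F x) (sff x u v) (sff x w z) = \<epsilon> * (H u v * H w z)" for u v w z
    using \<epsilon> by (simp add: sff hs \<epsilon>_def[symmetric] algebra_simps)
  then show ?thesis using gauss_equation[OF x, of u v w z]
    by (simp add: \<epsilon>_def[symmetric] algebra_simps)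
qed

end

section \<open>The pointwise identity\<close>

text \<open>Three summands, as in the decompositions \<open>weyl_formula\<close> and
  \<open>W_formula\<close>.\<close>

lemma Q_lincomb:
  "Q A (\<lambda>u v w z. c * T u v w z + d * T' u v w z + e * T'' u v w z) X1 X2 X3 X4 X5 X6 =
     c * Q A T X1 X2 X3 X4 X5 X6 + d * Q A T' X1 X2 X3 X4 X5 X6 + e * Q A T'' X1 X2 X3 X4 X5 X6"
  by (simp add: Q_def dot_def algebra_simps)

text \<open>Both sides are sums of products of one value of \<open>A\<close> and two of
  \<open>B\<close>; they agree once the symmetric arguments are put in a fixed order.\<close>

lemma Q_kulkarni_nomizu_swap:
  assumes A: "bilinear A" "\<And>u v. A u v = A v u" and B: "bilinear B" "\<And>u v. B u v = B v u"
  shows "Q A (const_curv_tensor B) X1 X2 X3 X4 X5 X6 = - Q B (kulkarni_nomizu A B) X1 X2 X3 X4 X5 X6"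
proof -
  note simps = bilinear_ladd bilinear_radd bilinear_lsub bilinear_rsub bilinear_lmul bilinear_rmul
  have sym: "A X2 X1 = A X1 X2" "A X3 X1 = A X1 X3" "A X4 X1 = A X1 X4" "A X5 X1 = A X1 X5" "A X6 X1 = A X1 X6"
     "A X3 X2 = A X2 X3" "A X4 X2 = A X2 X4" "A X5 X2 = A X2 X5" "A X6 X2 = A X2 X6"
     "A X4 X3 = A X3 X4" "A X5 X3 = A X3 X5" "A X6 X3 = A X3 X6"
     "A X5 X4 = A X4 X5" "A X6 X4 = A X4 X6" "A X6 X5 = A X5 X6"
     "B X2 X1 = B X1 X2" "B X3 X1 = B X1 X3" "B X4 X1 = B X1 X4" "B X5 X1 = B X1 X5" "B X6 X1 = B X1 X6"
     "B X3 X2 = B X2 X3" "B X4 X2 = B X2 X4" "B X5 X2 = B X2 X5" "B X6 X2 = B X2 X6"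
     "B X4 X3 = B X3 X4" "B X5 X3 = B X3 X5" "B X6 X3 = B X3 X6"
     "B X5 X4 = B X4 X5" "B X6 X4 = B X4 X6" "B X6 X5 = B X5 X6"
    by (rule A(2) B(2))+
  show ?thesis
    unfolding Q_def dot_def const_curv_tensor_def kulkarni_nomizu_def wedge_def
    by (simp add: simps[OF A(1)] simps[OF B(1)] sym algebra_simps)
qed

text \<open>Taking both forms equal in the exchange rule shows that the value is minus twice
  itself.\<close>

lemma Q_const_curv_tensor_self:
  assumes A: "bilinear A" "\<And>u v. A u v = A v u"
  shows "Q A (const_curv_tensor A) X1 X2 X3 X4 X5 X6 = 0"
proof -
  have "kulkarni_nomizu A A = (\<lambda>u v w z. 2 * const_curv_tensor A u v w z)"
    by (auto simp: kulkarni_nomizu_def const_curv_tensor_def fun_eq_iff)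
  then have "Q A (kulkarni_nomizu A A) X1 X2 X3 X4 X5 X6 = 2 * Q A (const_curv_tensor A) X1 X2 X3 X4 X5 X6"
    using Q_lincomb[of A 2 "const_curv_tensor A" 0 "const_curv_tensor A" 0 "const_curv_tensor A"] by simp
  then show ?thesis using Q_kulkarni_nomizu_swap[OF A A] by simp
qed

text \<open>When the second fundamental tensor has rank two, the Gauss equation takes the form
  \<open>R = k G + lam (\<omega> \<otimes> \<omega>)\<close> with \<open>\<omega>\<close> the decomposable 2-form of the vectors \<open>p\<close> and \<open>q\<close>.\<close>

locale rank_two_point = chart_metric G U
  for G :: "real^'n \<Rightarrow> (real^'n) bilin" and U +
  fixes x p q :: "real^'n" and lam k n :: real
  assumes x: "x \<in> U" and dim: "CARD('n) \<ge> 3" and n: "n = real CARD('n)"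
    and riem_eq: "riem G x u v w z = k * const_curv_tensor (G x) u v w z
      + lam * (G x p u * G x q v - G x q u * G x p v) * (G x p w * G x q z - G x q w * G x p z)"
begin

abbreviation b :: "(real^'n) bilin" where "b \<equiv> G x"
text \<open>With \<open>\<alpha>\<close> and \<open>\<beta>\<close> the rational coefficients become
  polynomials, subject to the relations \<open>alpha\<close> and \<open>beta\<close>.\<close>

definition \<alpha> :: real where "\<alpha> = 1 / (n - 2)"
definition \<beta> :: real where "\<beta> = 1 / (n - 1)"

definition om :: "(real^'n) bilin" where "om u v = b p u * b q v - b q u * b p v"
definition J :: "real^'n \<Rightarrow> real^'n" where "J z = b p z *\<^sub>R q - b q z *\<^sub>R p"
text \<open>Minus \<open>lam\<close> times the Gram determinant of \<open>p\<close> and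
  \<open>q\<close>; it is the scalar for which \<open>lam\<close> times the cube of \<open>J\<close>
  equals \<open>\<tau>\<close> times \<open>J\<close>.\<close>

definition \<tau> :: real where "\<tau> = lam * ((b p q)\<^sup>2 - b p p * b q q)"
definition Dop :: "real^'n \<Rightarrow> real^'n" where "Dop u = lam *\<^sub>R J (J u)"
definition D :: "(real^'n) bilin" where "D u v = lam * om (J u) v"

section \<open>Algebra of the 2-form, its skew operator and the square of that operator\<close>

lemmas bs = G_simps[OF x] and b_sym = G_sym[OF x]

lemma bilinear_om: "bilinear om"
  unfolding bilinear_def om_def by (auto intro!: linearI simp: bs algebra_simps)

lemma linear_J: "linear J"
  unfolding J_def by (auto intro!: linearI simp: bs algebra_simps)

lemma bilinear_D: "bilinear D"
  unfolding bilinear_def D_def om_def J_def by (auto intro!: linearI simp: bs algebra_simps)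

lemmas oms = bilinear_ladd[OF bilinear_om] bilinear_radd[OF bilinear_om]
  bilinear_lsub[OF bilinear_om] bilinear_rsub[OF bilinear_om]
  bilinear_lmul[OF bilinear_om] bilinear_rmul[OF bilinear_om]
lemmas Ds = bilinear_ladd[OF bilinear_D] bilinear_radd[OF bilinear_D]
  bilinear_lsub[OF bilinear_D] bilinear_rsub[OF bilinear_D]
  bilinear_lmul[OF bilinear_D] bilinear_rmul[OF bilinear_D]

lemma om_antisym: "om u v = - om v u"
  by (simp add: om_def)

lemma b_J: "b (J u) v = om u v"
  by (simp add: J_def om_def bs)

lemma b_J': "b u (J v) = - om u v"
  using b_J b_sym om_antisym by metis

lemma om_J': "om u (J v) = - om (J u) v"
  by (simp add: om_def J_def bs b_sym[of q p] algebra_simps)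

lemma D_sym: "D u v = D v u"
  using om_J'[of u v] om_antisym[of u "J v"] by (simp add: D_def)

lemma b_Dop: "b (Dop u) v = D u v"
  by (simp add: Dop_def D_def bs b_J)

lemma b_Dop': "b u (Dop v) = D u v"
  using b_Dop b_sym D_sym by metis

lemma om_Dop: "om (Dop u) v = \<tau> * om u v"
  by (simp add: Dop_def om_def J_def bs \<tau>_def b_sym[of q p] power2_eq_square algebra_simps)

lemma om_Dop': "om u (Dop v) = \<tau> * om u v"
  using om_Dop[of v u] om_antisym[of u "Dop v"] om_antisym[of u v] by simp

lemma D_J: "D (J u) v = \<tau> * om u v"
  using om_Dop[of u v] by (simp add: D_def Dop_def oms)

lemma D_J': "D u (J v) = - \<tau> * om u v"
  using D_J[of v u] D_sym[of u "J v"] om_antisym[of u v] by simp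

lemma D_Dop: "D (Dop u) v = \<tau> * D u v"
  by (simp add: Dop_def Ds D_J) (simp add: D_def)

text \<open>The expression is skew in \<open>v\<close>, \<open>w\<close> and in \<open>u\<close>,
  \<open>z\<close> and involves only the functionals \<open>b p\<close> and \<open>b q\<close>, so
  it is a multiple of a product of two values of \<open>om\<close>; the factor vanishes by symmetry
  of \<open>D\<close>. In other words, every \<open>wedge D y z\<close> annihilates
  \<open>om\<close> as a derivation.\<close>

lemma D_om_cyclic: "D v u * om w z - D w u * om v z + D v z * om u w - D w z * om u v = 0"
  unfolding D_def om_def J_def by (simp add: bs b_sym[of q p]) algebra

lemma trace_Dop: "trace (matrix Dop) = 2 * \<tau>"
proof -
  have "Dop = (\<lambda>z. (lam * (b p z * b p q - b q z * b p p)) *\<^sub>R q + (lam * (b q z * b p q - b p z * b q q)) *\<^sub>R p)"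
    by (simp add: Dop_def J_def bs b_sym[of q p] fun_eq_iff algebra_simps)
  moreover have "linear (\<lambda>z. lam * (b p z * b p q - b q z * b p p))" "linear (\<lambda>z. lam * (b q z * b p q - b p z * b q q))"
    by (auto intro!: linearI simp: bs algebra_simps)
  ultimately have "trace (matrix Dop) = lam * (b p q * b p q - b q q * b p p) + lam * (b q p * b p q - b p p * b q q)"
    by (simp only: trace_matrix_add trace_rank_one)
  then show ?thesis
    by (simp add: \<tau>_def b_sym[of q p] power2_eq_square algebra_simps)
qed

section \<open>Ricci and Weyl tensors in terms of \<open>b\<close>, \<open>om\<close> and
  \<open>D\<close>\<close>

lemma n_pos: "n - 2 > 0" "n - 1 > 0" "n - 2 \<noteq> 0" "n - 1 \<noteq> 0"
  using dim by (auto simp: n)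

lemma alpha: "\<alpha> * (n - 2) = 1" and beta: "\<beta> * (n - 1) = 1" and divide_eq_beta: "y / (n - 1) = y * \<beta>"
  using n_pos by (simp_all add: \<alpha>_def \<beta>_def)

lemma alpha_minus_beta: "\<alpha> - \<beta> = \<alpha> * \<beta>"
  using alpha beta by algebra

lemma curv_formula: "curv G x u v w = k *\<^sub>R wedge b u v w + (lam * om u v) *\<^sub>R J w"
proof (rule metric_at_eqI[OF metric[OF x]])
  show "b (curv G x u v w) z = b (k *\<^sub>R wedge b u v w + (lam * om u v) *\<^sub>R J w) z" for z
    using riem_eq[of u v w z]
    by (simp add: riem_def lower_def wedge_def bs b_J const_curv_tensor_def)
       (simp add: om_def algebra_simps)
qed

lemma ricci_formula: "ricci G x u v = (n - 1) * k * b u v + D u v"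
proof -
  have "(\<lambda>Z. curv G x Z u v) = (\<lambda>Z. ((k * b u v) *\<^sub>R Z - (k * b Z v) *\<^sub>R u) + (lam * om Z u) *\<^sub>R J v)"
    by (simp add: curv_formula wedge_def fun_eq_iff algebra_simps)
  moreover have "linear (\<lambda>Z. k * b Z v)" "linear (\<lambda>Z. lam * om Z u)"
    by (auto intro!: linearI simp: bs oms algebra_simps)
  ultimately have "ricci G x u v = k * b u v * n - k * b u v + lam * om (J v) u"
    unfolding ricci_def
    by (simp add: trace_matrix_add trace_matrix_diff trace_matrix_scaleR trace_matrix_ident trace_rank_one n)
  also have "lam * om (J v) u = D u v"
    using D_sym[of v u] by (simp only: D_def)
  finally show ?thesis by (simp add: algebra_simps)
qed

lemma ricci_op_formula: "ricci_op G x u = ((n - 1) * k) *\<^sub>R u + Dop u"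
  by (rule ricci_op_eqI[OF x]) (simp add: ricci_formula bs b_Dop)

lemma scalar_curv_formula: "scalar_curv G x = n * (n - 1) * k + 2 * \<tau>"
proof -
  have "ricci_op G x = (\<lambda>u. ((n - 1) * k) *\<^sub>R u + Dop u)"
    by (simp add: ricci_op_formula fun_eq_iff)
  then show ?thesis
    by (simp add: scalar_curv_def trace_matrix_add trace_matrix_scaleR trace_matrix_ident trace_Dop n)
qed

lemma ricci_sq_formula: "ricci_sq G x u v = ((n - 1) * k)\<^sup>2 * b u v + (2 * (n - 1) * k + \<tau>) * D u v"
  unfolding ricci_sq_def ricci_op_formula ricci_formula
  by (simp add: bs Ds b_Dop D_Dop power2_eq_square algebra_simps)

lemma weyl_endo_formula:
  "weyl_endo G x u v w = (lam * om u v) *\<^sub>R J w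
    - \<alpha> *\<^sub>R (wedge b u (Dop v) w + wedge b (Dop u) v w) + (2 * \<tau> * \<alpha> * \<beta>) *\<^sub>R wedge b u v w"
proof (rule metric_at_eqI[OF metric[OF x]])
  fix z
  \<comment> \<open>The total coefficient of \<open>wedge b u v w\<close>: the multiples of
    \<open>k\<close> cancel, and only the contribution of \<open>\<tau>\<close> to the scalar
    curvature survives.\<close>
  have c: "k - \<alpha> * (2 * (n - 1) * k - scalar_curv G x * \<beta>) = 2 * \<tau> * \<alpha> * \<beta>"
  proof -
    have "scalar_curv G x * \<beta> = n * k + 2 * \<tau> * \<beta>"
      unfolding scalar_curv_formula using beta by algebra
    then show ?thesis using alpha by algebra
  qed
  have "b (weyl_endo G x u v w) z =
      (k - \<alpha> * (2 * (n - 1) * k - scalar_curv G x * \<beta>)) * b (wedge b u v w) z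
      + lam * om u v * om w z - \<alpha> * (b (wedge b u (Dop v) w) z + b (wedge b (Dop u) v w) z)"
    unfolding weyl_endo_def n[symmetric] \<alpha>_def[symmetric] divide_eq_beta curv_formula ricci_op_formula wedge_def
    by (simp add: bs b_J) (simp add: algebra_simps)
  then show "b (weyl_endo G x u v w) z = b ((lam * om u v) *\<^sub>R J w
    - \<alpha> *\<^sub>R (wedge b u (Dop v) w + wedge b (Dop u) v w) + (2 * \<tau> * \<alpha> * \<beta>) *\<^sub>R wedge b u v w) z"
    unfolding c by (simp add: bs b_J)
qed

definition T :: "(real^'n) tensor4" where "T u v w z = lam * om u v * om w z"

lemma weyl_formula:
  "weyl G x = (\<lambda>u v w z. 1 * T u v w z + (- \<alpha>) * kulkarni_nomizu b D u v w z
    + (2 * \<tau> * \<alpha> * \<beta>) * const_curv_tensor b u v w z)"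
  unfolding weyl_def lower_def weyl_endo_formula wedge_def T_def kulkarni_nomizu_def const_curv_tensor_def
  by (simp add: fun_eq_iff bs b_J b_Dop) (simp add: algebra_simps)

text \<open>The Weyl endomorphism annihilates \<open>b\<close> as a derivation; hence the constant
  curvature part of \<open>riem\<close> contributes nothing in \<open>dot_weyl_riem\<close>.\<close>

lemma weyl_endo_skew: "b u (weyl_endo G x y z v) = - b (weyl_endo G x y z u) v"
proof -
  have "b (weyl_endo G x y z u) v + b (weyl_endo G x y z v) u = 0"
    unfolding weyl_endo_formula wedge_def
    by (simp add: bs b_J b_J' b_Dop b_Dop' b_sym[of _ u] b_sym[of _ v] D_sym[of _ u] D_sym[of _ v] om_antisym[of u v])
       (simp add: algebra_simps)
  then show ?thesis using b_sym[of u] by simp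
qed

text \<open>The \<open>J\<close> part acts trivially on \<open>om\<close>. Terms with
  \<open>Dop\<close> inside \<open>om\<close> give \<open>\<tau>\<close> times the action of
  \<open>wedge b y z\<close>, and those with a value of \<open>D\<close> as coefficient cancel by
  \<open>D_om_cyclic\<close>.\<close>

lemma om_weyl_endo:
  "om (weyl_endo G x y z u) v + om u (weyl_endo G x y z v) =
     \<tau> * \<alpha> * (2 * \<beta> - 1) * (om (wedge b y z u) v + om u (wedge b y z v))"
proof -
  have "om (weyl_endo G x y z u) v + om u (weyl_endo G x y z v) =
     \<tau> * \<alpha> * (2 * \<beta> - 1) * (om (wedge b y z u) v + om u (wedge b y z v))
     - \<alpha> * (D z u * om y v - D y u * om z v + D z v * om u y - D y v * om u z)"
    unfolding weyl_endo_formula wedge_def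
    by (simp add: oms om_J' om_Dop om_Dop' b_Dop) (simp add: algebra_simps)
  then show ?thesis using D_om_cyclic[of z u y v] by simp
qed

lemma dot_weyl_riem:
  "dot (weyl_endo G x) (riem G x) X1 X2 X3 X4 X5 X6 = \<tau> * \<alpha> * (2 * \<beta> - 1) * Q b T X1 X2 X3 X4 X5 X6"
proof -
  have riem: "riem G x u v w z = k * (b u z * b v w - b u w * b v z) + lam * om u v * om w z" for u v w z
    by (simp add: riem_eq const_curv_tensor_def om_def)
  define c where "c = \<tau> * \<alpha> * (2 * \<beta> - 1)"
  define E where "E = weyl_endo G x X5 X6"
  define W where "W = wedge b X5 X6"
  have skew: "b u (E v) = - b (E u) v" for u v
    unfolding E_def by (rule weyl_endo_skew)
  have omE: "om u (E v) = c * (om (W u) v + om u (W v)) - om (E u) v" for u v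
    using om_weyl_endo[of X5 X6 u v] unfolding E_def W_def c_def by simp
  show ?thesis
    unfolding Q_def dot_def T_def riem E_def[symmetric] W_def[symmetric] c_def[symmetric]
    by (simp add: skew omE b_sym[of "E X3"] b_sym[of "E X4"]) (simp add: algebra_simps)
qed

lemma dot_curv_weyl: "dot (curv G x) (weyl G x) X1 X2 X3 X4 X5 X6 = k * Q b (weyl G x) X1 X2 X3 X4 X5 X6"
proof -
  define W where "W = wedge b X5 X6"
  define c where "c = lam * om X5 X6"
  show ?thesis
    unfolding Q_def dot_def weyl_formula T_def kulkarni_nomizu_def const_curv_tensor_def curv_formula
      W_def[symmetric] c_def[symmetric]
    by (simp add: bs oms Ds b_J b_J' om_J' D_J D_J') (simp add: algebra_simps)
qed

section \<open>The terms on the right-hand side of the identity\<close>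

lemma Q_ricci_weyl:
  "Q (ricci G x) (weyl G x) X1 X2 X3 X4 X5 X6 =
    (n - 1) * k * Q b (weyl G x) X1 X2 X3 X4 X5 X6 + Q D (weyl G x) X1 X2 X3 X4 X5 X6"
proof -
  define W where "W = wedge b X5 X6"
  define W' where "W' = wedge D X5 X6"
  define c where "c = (n - 1) * k"
  have "wedge (ricci G x) X5 X6 = (\<lambda>z. c *\<^sub>R W z + W' z)"
    by (simp add: wedge_def W_def W'_def c_def ricci_formula fun_eq_iff algebra_simps)
  then show ?thesis
    unfolding Q_def dot_def weyl_formula T_def kulkarni_nomizu_def const_curv_tensor_def
      W_def[symmetric] W'_def[symmetric] c_def[symmetric]
    by (simp add: bs oms Ds) (simp add: algebra_simps)
qed

lemma Q_D_T: "Q D T X1 X2 X3 X4 X5 X6 = 0"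
proof -
  have *: "om u (wedge D y z v) = - om (wedge D y z u) v" for u v y z
    using D_om_cyclic[of z u y v] by (simp add: wedge_def oms)
  show ?thesis unfolding Q_def dot_def T_def by (simp add: *)
qed

text \<open>The tensor to which \<open>Q b\<close> is applied in the last term of the
  identity.\<close>

definition W :: "(real^'n) tensor4" where
  "W Y1 Y2 Y3 Y4 = kulkarni_nomizu b (ricci_sq G x) Y1 Y2 Y3 Y4
     + (n - 2) / 2 * kulkarni_nomizu (ricci G x) (ricci G x) Y1 Y2 Y3 Y4
     - scalar_curv G x * kulkarni_nomizu b (ricci G x) Y1 Y2 Y3 Y4"

text \<open>With c = (n - 1) k, the coefficient of \<open>kulkarni_nomizu b D\<close> is (2 c +
  \<tau>) + (n - 2) c - \<kappa>, which is -\<tau> because \<kappa> = n c + 2 \<tau>.\<close>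

lemma W_formula:
  "W = (\<lambda>u v w z. (n * ((n - 1) * k)\<^sup>2 - 2 * scalar_curv G x * ((n - 1) * k)) * const_curv_tensor b u v w z
    + (- \<tau>) * kulkarni_nomizu b D u v w z + (n - 2) * const_curv_tensor D u v w z)"
proof -
  define c where "c = (n - 1) * k"
  have "scalar_curv G x = n * c + 2 * \<tau>" by (simp add: scalar_curv_formula c_def)
  moreover have "ricci G x = (\<lambda>u v. c * b u v + D u v)" by (simp add: ricci_formula c_def fun_eq_iff)
  moreover have "ricci_sq G x = (\<lambda>u v. c\<^sup>2 * b u v + (2 * c + \<tau>) * D u v)"
    by (simp add: ricci_sq_formula c_def fun_eq_iff)
  ultimately show ?thesis
    unfolding W_def c_def[symmetric]
    by (simp add: fun_eq_iff kulkarni_nomizu_def const_curv_tensor_def power2_eq_square field_simps)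
qed

lemma Q_W:
  "Q b W X1 X2 X3 X4 X5 X6 = - \<tau> * Q b (kulkarni_nomizu b D) X1 X2 X3 X4 X5 X6
    + (n - 2) * Q b (const_curv_tensor D) X1 X2 X3 X4 X5 X6"
  unfolding W_formula Q_lincomb Q_const_curv_tensor_self[OF G_bilinear[OF x] b_sym] by simp

text \<open>The coefficient of \<open>Q b (weyl G x)\<close> comes from comparing multiples of
  \<open>Q b T\<close>: the factor in \<open>dot_weyl_riem\<close>, minus k from
  \<open>dot_curv_weyl\<close>, minus (n - 1) k from \<open>Q_ricci_weyl\<close>.\<close>

theorem weyl_riem_identity:
  "dot (weyl_endo G x) (riem G x) X1 X2 X3 X4 X5 X6 - dot (curv G x) (weyl G x) X1 X2 X3 X4 X5 X6 =
    Q (ricci G x) (weyl G x) X1 X2 X3 X4 X5 X6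
    + ((scalar_curv G x - n * (n - 1) * k) / 2 * \<alpha> * (2 * \<beta> - 1) - n * k) * Q b (weyl G x) X1 X2 X3 X4 X5 X6
    - 1 / (n - 2)\<^sup>2 * Q b W X1 X2 X3 X4 X5 X6"
proof -
  define q1 where "q1 = Q b T X1 X2 X3 X4 X5 X6"
  define q2 where "q2 = Q b (kulkarni_nomizu b D) X1 X2 X3 X4 X5 X6"
  define q3 where "q3 = Q b (const_curv_tensor D) X1 X2 X3 X4 X5 X6"
  define C where "C = Q b (weyl G x) X1 X2 X3 X4 X5 X6"
  have C: "C = q1 - \<alpha> * q2"
    unfolding C_def weyl_formula Q_lincomb Q_const_curv_tensor_self[OF G_bilinear[OF x] b_sym] q1_def q2_def by simp
  have kn: "kulkarni_nomizu D b = kulkarni_nomizu b D"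
    by (simp add: kulkarni_nomizu_def fun_eq_iff algebra_simps)
  have D: "Q D (weyl G x) X1 X2 X3 X4 X5 X6 = \<alpha> * q3 - 2 * \<tau> * \<alpha> * \<beta> * q2"
    unfolding weyl_formula Q_lincomb Q_D_T q3_def q2_def
      Q_kulkarni_nomizu_swap[OF G_bilinear[OF x] b_sym bilinear_D D_sym]
      Q_kulkarni_nomizu_swap[OF bilinear_D D_sym G_bilinear[OF x] b_sym] kn
    by simp
  \<comment> \<open>The vectors \<open>p\<close>, \<open>q\<close> and the factor \<open>lam\<close>
    may vary with the chart; writing \<open>\<tau>\<close> through the scalar curvature frees the
    coefficient from them.\<close>
  have \<tau>: "(scalar_curv G x - n * (n - 1) * k) / 2 = \<tau>" by (simp add: scalar_curv_formula)
  \<comment> \<open>The multiples of \<open>q2\<close> on the two sides match because of this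
    relation.\<close>
  have ab: "\<alpha> * \<alpha> * \<beta> = \<alpha> * \<alpha> - \<alpha> * \<beta>"
    using alpha_minus_beta by (metis mult.assoc right_diff_distrib)
  have "1 / (n - 2)\<^sup>2 = \<alpha> * \<alpha>" by (simp add: \<alpha>_def power2_eq_square)
  then have "1 / (n - 2)\<^sup>2 * (- \<tau> * q2 + (n - 2) * q3) = \<alpha> * q3 - \<alpha> * \<alpha> * \<tau> * q2"
    using alpha by algebra
  moreover have "\<tau> * \<alpha> * (2 * \<beta> - 1) * (\<alpha> * q2) = - 2 * \<tau> * \<alpha> * \<beta> * q2 + \<alpha> * \<alpha> * \<tau> * q2"
  proof -
    have "\<tau> * \<alpha> * (2 * \<beta> - 1) * (\<alpha> * q2) = \<tau> * q2 * (2 * (\<alpha> * \<alpha> * \<beta>) - \<alpha> * \<alpha>)"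
      by (simp add: algebra_simps)
    then show ?thesis unfolding ab by (simp add: algebra_simps)
  qed
  ultimately show ?thesis
    unfolding dot_weyl_riem dot_curv_weyl Q_ricci_weyl Q_W D \<tau>
      q1_def[symmetric] q2_def[symmetric] q3_def[symmetric] C_def[symmetric]
    by (simp add: C algebra_simps)
qed

text \<open>With \<open>E\<close> the rank one form, \<open>D\<close> is \<open>E\<close> plus a
  multiple of \<open>b\<close>. Then \<open>W\<close> consists of a multiple of
  \<open>const_curv_tensor b\<close>, the minors of \<open>E\<close>, which vanish, and mixed terms,
  which \<open>key\<close> reduces to \<open>b\<close>.\<close>

lemma Q_W_quasi_einstein:
  assumes r: "bilin_rank (\<lambda>u v. ricci G x u v - a * b u v) = 1"
  shows "Q b W X1 X2 X3 X4 X5 X6 = 0"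
proof -
  define \<gamma> where "\<gamma> = a - (n - 1) * k"
  define E where "E = (\<lambda>u v. ricci G x u v - a * b u v)"
  have E: "E u v = D u v - \<gamma> * b u v" for u v
    by (simp add: E_def \<gamma>_def ricci_formula algebra_simps)
  have "bilinear E" unfolding bilinear_def E by (auto intro!: linearI simp: bs Ds algebra_simps)
  then obtain s t where st: "linear s" "linear t" "\<And>u v. E u v = s u * t v"
    using rank_one_form[of E] r unfolding E_def by metis
  obtain r where r: "\<And>v. b r v = t v" using metric_riesz[OF metric[OF x] st(2)] by blast
  have Eop: "Dop u - \<gamma> *\<^sub>R u = s u *\<^sub>R r" for u
    by (rule metric_at_eqI[OF metric[OF x]]) (simp add: bs b_Dop r st(3)[symmetric] E)
  have "trace (matrix (\<lambda>u. Dop u - \<gamma> *\<^sub>R u)) = trace (matrix (\<lambda>u. s u *\<^sub>R r))"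
    unfolding Eop ..
  then have tr: "s r = 2 * \<tau> - \<gamma> * n"
    by (simp add: trace_matrix_diff trace_matrix_scaleR trace_matrix_ident trace_rank_one[OF st(1)] trace_Dop n)
  \<comment> \<open>A rank one operator squares to its trace times itself. Combined with the trace
    \<open>tr\<close> and the relation \<open>D_Dop\<close>, this ties \<open>E\<close> to
    \<open>b\<close>.\<close>
  have key: "((n - 2) * \<gamma> - \<tau>) * E u v = - \<gamma> * (\<tau> - \<gamma>) * b u v" for u v
  proof -
    have "E (Dop u - \<gamma> *\<^sub>R u) v = s r * E u v"
      unfolding Eop st(3) by (simp add: linear_scale[OF st(1)])
    then have "\<tau> * D u v - \<gamma> * D u v - \<gamma> * E u v = (2 * \<tau> - \<gamma> * n) * E u v"
      by (simp add: tr E bs Ds D_Dop b_Dop algebra_simps)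
    moreover have "D u v = E u v + \<gamma> * b u v" by (simp add: E)
    ultimately show ?thesis by algebra
  qed
  have cc: "E u z * E v w - E u w * E v z = 0" for u v w z
    by (simp add: st(3))
  define c where "c = n * ((n - 1) * k)\<^sup>2 - 2 * scalar_curv G x * ((n - 1) * k)"
  have "W u v w z = (c - 2 * \<tau> * \<gamma> + (n - 2) * \<gamma>\<^sup>2 - 2 * \<gamma> * (\<tau> - \<gamma>)) * const_curv_tensor b u v w z" for u v w z
  proof -
    have D: "D = (\<lambda>u v. E u v + \<gamma> * b u v)" by (simp add: E fun_eq_iff)
    have "W u v w z = (c - 2 * \<tau> * \<gamma> + (n - 2) * \<gamma>\<^sup>2) * const_curv_tensor b u v w z
      + (n - 2) * (E u z * E v w - E u w * E v z)
      + (b u z * (((n - 2) * \<gamma> - \<tau>) * E v w) + b v w * (((n - 2) * \<gamma> - \<tau>) * E u z)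
       - b u w * (((n - 2) * \<gamma> - \<tau>) * E v z) - b v z * (((n - 2) * \<gamma> - \<tau>) * E u w))"
      unfolding W_formula D c_def[symmetric] kulkarni_nomizu_def const_curv_tensor_def by algebra
    then show ?thesis unfolding cc key by (simp add: const_curv_tensor_def algebra_simps)
  qed
  then have "W = (\<lambda>u v w z. (c - 2 * \<tau> * \<gamma> + (n - 2) * \<gamma>\<^sup>2 - 2 * \<gamma> * (\<tau> - \<gamma>)) * const_curv_tensor b u v w z
      + 0 * const_curv_tensor b u v w z + 0 * const_curv_tensor b u v w z)"
    by (simp add: fun_eq_iff)
  then show ?thesis
    by (simp only: Q_lincomb Q_const_curv_tensor_self[OF G_bilinear[OF x] b_sym])
qed

end

section \<open>Charts\<close>

lemma smooth_on_subset:
  assumes "smooth_on f U" "V \<subseteq> U"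
  shows "smooth_on f V"
proof -
  have "Ck_on k f U \<Longrightarrow> Ck_on k f V" for k
    using assms(2) by (induction k arbitrary: f) (auto intro: continuous_on_subset)
  then show ?thesis using assms(1) unfolding smooth_on_def by blast
qed

lemma smooth_atlas_chart:
  assumes "smooth_atlas X \<A>" "c \<in> \<A>"
  shows "openin X (fst c)" "open (snd c ` fst c)" "inj_on (snd c) (fst c)"
    "openin X W \<Longrightarrow> W \<subseteq> fst c \<Longrightarrow> open (snd c ` W)"
proof -
  note c = assms[unfolded smooth_atlas_def]
  show o: "openin X (fst c)" "open (snd c ` fst c)" using c by auto
  have h: "homeomorphic_map (subtopology X (fst c)) (top_of_set (snd c ` fst c)) (snd c)" using c by auto
  show "inj_on (snd c) (fst c)"
    using homeomorphic_imp_injective_map[OF h] openin_subset[OF o(1)] by (simp add: Int_absorb1)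
  assume W: "openin X W" "W \<subseteq> fst c"
  have "openin (subtopology X (fst c)) W"
    using W by (auto simp: openin_subtopology)
  then have "openin (top_of_set (snd c ` fst c)) (snd c ` W)"
    using homeomorphic_imp_open_map[OF h] by (simp add: open_map_def)
  then show "open (snd c ` W)" using o(2) openin_open_trans by blast
qed

lemma chart_metric_atlas:
  assumes "smooth_atlas X \<A>" "semi_riemannian_metric \<A> g" "c \<in> \<A>"
  shows "chart_metric (g c) (snd c ` fst c)"
  by unfold_locales (use assms smooth_atlas_chart(2)[OF assms(1,3)] in \<open>auto simp: semi_riemannian_metric_def\<close>)

lemma coord_map_chart:
  assumes "smooth_atlas X \<A>" "c \<in> \<A>" "p \<in> fst c"
  shows "coord_map f c d (snd c p) = snd d (f p)"
  using smooth_atlas_chart(3)[OF assms(1,2)] assms(3) by (simp add: coord_map_def)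

text \<open>Continuity of \<open>f\<close> makes the coordinate domain open. The lemma is used for
  the immersion and, with the identity as \<open>f\<close>, for changes of charts.\<close>

lemma isometric_chart_map_coord:
  fixes g :: "('p, real^'n) tensor2_field" and h :: "('q, real^'m) tensor2_field"
  assumes A: "smooth_atlas X \<A>" "semi_riemannian_metric \<A> g" "c \<in> \<A>"
    and B: "smooth_atlas Y \<B>" "semi_riemannian_metric \<B> h" "d \<in> \<B>"
    and f: "continuous_map X Y f" "smooth_on (coord_map f c d) (coord_dom f c d)" "pulls_back f \<A> g \<B> h"
  shows "isometric_chart_map (g c) (coord_dom f c d) (h d) (snd d ` fst d) (coord_map f c d)"
proof -
  interpret M: chart_metric "g c" "snd c ` fst c" by (rule chart_metric_atlas[OF A])
  interpret N: chart_metric "h d" "snd d ` fst d" by (rule chart_metric_atlas[OF B])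
  have sub: "coord_dom f c d \<subseteq> snd c ` fst c" unfolding coord_dom_def by blast
  show ?thesis
  proof unfold_locales
    have "openin X {p \<in> topspace X. f p \<in> fst d}"
      using f(1) smooth_atlas_chart(1)[OF B(1,3)] by (simp add: continuous_map)
    moreover have "fst c \<inter> f -` fst d = fst c \<inter> {p \<in> topspace X. f p \<in> fst d}"
      using openin_subset[OF smooth_atlas_chart(1)[OF A(1,3)]] by blast
    ultimately have "openin X (fst c \<inter> f -` fst d)"
      using smooth_atlas_chart(1)[OF A(1,3)] by (metis openin_Int)
    then show "open (coord_dom f c d)"
      unfolding coord_dom_def using smooth_atlas_chart(4)[OF A(1,3)] by blast
    show "metric_at (g c x)" if "x \<in> coord_dom f c d" for x using M.metric sub that by blast
    show "smooth_on (\<lambda>x. g c x u v) (coord_dom f c d)" for u v using smooth_on_subset[OF M.smooth sub] .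
    show "smooth_on (coord_map f c d) (coord_dom f c d)" by (rule f(2))
    show "coord_map f c d ` coord_dom f c d \<subseteq> snd d ` fst d"
      by (auto simp: coord_dom_def coord_map_chart[OF A(1,3)])
    show "g c x u v = h d (coord_map f c d x) (frechet_derivative (coord_map f c d) (at x) u)
        (frechet_derivative (coord_map f c d) (at x) v)" if "x \<in> coord_dom f c d" for x u v
      using f(3) A(3) B(3) that unfolding pulls_back_def by blast
  qed
qed

lemma scalar_curv_chart_independent:
  fixes g :: "('p, real^'n) tensor2_field"
  assumes A: "smooth_atlas X \<A>" "semi_riemannian_metric \<A> g"
    and c: "c \<in> charts_at \<A> p" "d \<in> charts_at \<A> p"
  shows "scalar_curv (g c) (snd c p) = scalar_curv (g d) (snd d p)"
proof -
  have cd: "c \<in> \<A>" "d \<in> \<A>" "p \<in> fst c" "p \<in> fst d" using c by (auto simp: charts_at_def)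
  interpret isometric_chart_map "g c" "coord_dom id c d" "g d" "snd d ` fst d" "coord_map id c d"
    by (rule isometric_chart_map_coord[OF A cd(1) A cd(2)])
       (use A cd in \<open>auto simp: smooth_atlas_def semi_riemannian_metric_def\<close>)
  have "snd c p \<in> coord_dom id c d" using cd by (auto simp: coord_dom_def)
  from scalar_curv_isometric[OF this] show ?thesis
    by (simp add: coord_map_chart[OF A(1) cd(1,3)])
qed

text \<open>The Gauss equation turns constant curvature of the ambient space and rank two of the
  second fundamental tensor into the hypothesis of the pointwise locale.\<close>

lemma rank_two_point_chart:
  fixes g :: "('p, real^'n) tensor2_field" and h :: "('q, real^'m) tensor2_field"
  assumes dim: "CARD('n) \<ge> 3" "CARD('m) = CARD('n) + 1"
    and A: "smooth_atlas X \<A>" "semi_riemannian_metric \<A> g"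
    and B: "smooth_atlas Y \<B>" "semi_riemannian_metric \<B> h" "constant_curvature \<B> h k"
    and f: "isometric_immersion X \<A> g Y \<B> h f" "type_number_two X \<A> \<B> h f"
    and p: "p \<in> topspace X" "c \<in> charts_at \<A> p"
  shows "\<exists>a b lam. rank_two_point (g c) (snd c ` fst c) (snd c p) a b lam k (real CARD('n))"
proof -
  have c: "c \<in> \<A>" "p \<in> fst c" using p by (auto simp: charts_at_def)
  note f' = f(1)[unfolded isometric_immersion_def]
  have "f p \<in> topspace Y" using f' p(1) continuous_map_image_subset_topspace by fastforce
  then obtain d where d: "d \<in> \<B>" "f p \<in> fst d" using B(1) unfolding smooth_atlas_def by blast
  define x where "x = snd c p"
  define F where "F = coord_map f c d"
  interpret isometric_chart_map "g c" "coord_dom f c d" "h d" "snd d ` fst d" F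
    unfolding F_def
    by (rule isometric_chart_map_coord[OF A c(1) B(1,2) d(1)]) (use f' c d in auto)
  interpret chart: chart_metric "g c" "snd c ` fst c" by (rule chart_metric_atlas[OF A c(1)])
  have x: "x \<in> coord_dom f c d" using c d by (auto simp: coord_dom_def x_def)
  have "d \<in> charts_at \<B> (f p)" using d by (simp add: charts_at_def)
  then obtain \<xi> where \<xi>: "unit_normal (h d) F x \<xi>" "bilin_rank (second_fund (h d) F \<xi> x) = 2"
    using f(2) p unfolding type_number_two_def x_def F_def by blast
  obtain s t e where st: "linear s" "linear t"
    "\<And>u v w z. second_fund (h d) F \<xi> x u z * second_fund (h d) F \<xi> x v w
      - second_fund (h d) F \<xi> x u w * second_fund (h d) F \<xi> x v z
      = e * (s u * t v - t u * s v) * (s w * t z - t w * s z)"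
    using rank_two_form[OF bilinear_second_fund[OF x] second_fund_sym[OF x] \<xi>(2)] by blast
  \<comment> \<open>The vectors of the locale are the metric duals of the functionals; its factor
    \<open>lam\<close> will absorb the sign of the normal.\<close>
  obtain a b where ab: "\<And>v. g c x a v = s v" "\<And>v. g c x b v = t v"
    using metric_riesz[OF M.metric[OF x]] st(1,2) by metis
  have amb: "riem (h d) (F x) u v w z = k * const_curv_tensor (h d (F x)) u v w z" for u v w z
    by (rule N.riem_constant_curvature[OF FU[OF x]])
       (use dim B(3) d(1) FU[OF x] in \<open>auto simp: constant_curvature_def\<close>)
  have "riem (g c) x u v w z = k * const_curv_tensor (g c x) u v w z
      + h d (F x) \<xi> \<xi> * e * (g c x a u * g c x b v - g c x b u * g c x a v)
        * (g c x a w * g c x b z - g c x b w * g c x a z)" for u v w z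
    unfolding hypersurface_gauss_equation[OF x dim(2) \<xi>(1)] amb ab st(3)
    by (simp add: const_curv_tensor_def isometric[OF x])
  then have "rank_two_point (g c) (snd c ` fst c) x a b (h d (F x) \<xi> \<xi> * e) k (real CARD('n))"
    by unfold_locales (use dim c in \<open>auto simp: x_def\<close>)
  then show ?thesis unfolding x_def by blast
qed

theorem theorem7p6:
  fixes X :: "'p topology" and \<A> :: "('p, real^'n) chart set" and g :: "('p, real^'n) tensor2_field"
    and Y :: "'q topology" and \<B> :: "('q, real^'m) chart set" and h :: "('q, real^'m) tensor2_field"
    and f :: "'p \<Rightarrow> 'q" and k :: real and s :: nat
  assumes "CARD('n) \<ge> 4" and "CARD('m) = CARD('n) + 1"
    and "manifold Y \<B>" and "semi_riemannian_metric \<B> h" and "metric_index \<B> h s"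
    and "constant_curvature \<B> h k"
    and "manifold X \<A>" and "semi_riemannian_metric \<A> g"
    and "isometric_immersion X \<A> g Y \<B> h f"
    and "type_number_two X \<A> \<B> h f"
  shows "\<exists>L1 :: 'p \<Rightarrow> real.
    (\<forall>p \<in> U_S X \<A> g \<inter> U_C X \<A> g. \<forall>c \<in> charts_at \<A> p. \<forall>X1 X2 X3 X4 X5 X6.
       let n = real CARD('n); x = snd c p;
           gx = g c x; R = riem (g c) x; C = weyl (g c) x; S = ricci (g c) x;
           S2 = ricci_sq (g c) x; \<kappa> = scalar_curv (g c) x
       in dot (weyl_endo (g c) x) R X1 X2 X3 X4 X5 X6 - dot (curv (g c) x) C X1 X2 X3 X4 X5 X6 =
          Q S C X1 X2 X3 X4 X5 X6 + L1 p * Q gx C X1 X2 X3 X4 X5 X6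
          - 1 / (n - 2)\<^sup>2 *
            Q gx (\<lambda>Y1 Y2 Y3 Y4. kulkarni_nomizu gx S2 Y1 Y2 Y3 Y4
                     + (n - 2) / 2 * kulkarni_nomizu S S Y1 Y2 Y3 Y4
                     - \<kappa> * kulkarni_nomizu gx S Y1 Y2 Y3 Y4) X1 X2 X3 X4 X5 X6) \<and>
    (\<forall>\<alpha> :: 'p \<Rightarrow> real.
       (\<forall>p \<in> U_S X \<A> g \<inter> U_C X \<A> g. \<forall>c \<in> charts_at \<A> p.
          bilin_rank (\<lambda>u v. ricci (g c) (snd c p) u v - \<alpha> p * g c (snd c p) u v) = 1) \<longrightarrow>
       (\<forall>p \<in> U_S X \<A> g \<inter> U_C X \<A> g. \<forall>c \<in> charts_at \<A> p. \<forall>X1 X2 X3 X4 X5 X6.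
          let x = snd c p; R = riem (g c) x; C = weyl (g c) x; S = ricci (g c) x
          in dot (weyl_endo (g c) x) R X1 X2 X3 X4 X5 X6
               - dot (curv (g c) x) C X1 X2 X3 X4 X5 X6 =
             Q S C X1 X2 X3 X4 X5 X6 + L1 p * Q (g c x) C X1 X2 X3 X4 X5 X6))"
proof -
  let ?n = "real CARD('n)"
  have A: "smooth_atlas X \<A>" and B: "smooth_atlas Y \<B>"
    using assms(3,7) by (auto simp: manifold_def)
  \<comment> \<open>The coefficient from \<open>weyl_riem_identity\<close> as a function of the
    scalar curvature alone.\<close>
  define L where "L = (\<lambda>\<kappa>. (\<kappa> - ?n * (?n - 1) * k) / 2 * (1 / (?n - 2)) * (2 * (1 / (?n - 1)) - 1) - ?n * k)"
  \<comment> \<open>As \<open>L1\<close> must depend on the point only, it is read off in an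
    arbitrarily chosen chart; invariance of the scalar curvature makes the choice
    immaterial.\<close>
  define L1 where "L1 = (\<lambda>p. let c = SOME c. c \<in> charts_at \<A> p in L (scalar_curv (g c) (snd c p)))"
  have L1: "L1 p = L (scalar_curv (g c) (snd c p))" if "c \<in> charts_at \<A> p" for p c
    unfolding L1_def Let_def
    using scalar_curv_chart_independent[OF A assms(8) someI[of "\<lambda>c. c \<in> charts_at \<A> p", OF that] that]
    by simp
  show ?thesis
  proof (rule exI[of _ L1], intro conjI allI impI ballI)
    fix p c and X1 X2 X3 X4 X5 X6 :: "real^'n"
    assume p: "p \<in> U_S X \<A> g \<inter> U_C X \<A> g" "c \<in> charts_at \<A> p"
    then have "p \<in> topspace X" by (simp add: U_S_def)
    then obtain a b lam where "rank_two_point (g c) (snd c ` fst c) (snd c p) a b lam k ?n"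
      using rank_two_point_chart[OF _ assms(2) A assms(8) B assms(4,6,9,10) _ p(2)] assms(1) by auto
    then interpret rank_two_point "g c" "snd c ` fst c" "snd c p" a b lam k ?n .
    have W_eq: "W = (\<lambda>Y1 Y2 Y3 Y4. kulkarni_nomizu (g c (snd c p)) (ricci_sq (g c) (snd c p)) Y1 Y2 Y3 Y4
       + (?n - 2) / 2 * kulkarni_nomizu (ricci (g c) (snd c p)) (ricci (g c) (snd c p)) Y1 Y2 Y3 Y4
       - scalar_curv (g c) (snd c p) * kulkarni_nomizu (g c (snd c p)) (ricci (g c) (snd c p)) Y1 Y2 Y3 Y4)"
      by (simp add: W_def fun_eq_iff)
    note identity = weyl_riem_identity[of X1 X2 X3 X4 X5 X6, unfolded \<alpha>_def \<beta>_def, folded L1[OF p(2), unfolded L_def]]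
    show "let n = ?n; x = snd c p;
           gx = g c x; R = riem (g c) x; C = weyl (g c) x; S = ricci (g c) x;
           S2 = ricci_sq (g c) x; \<kappa> = scalar_curv (g c) x
       in dot (weyl_endo (g c) x) R X1 X2 X3 X4 X5 X6 - dot (curv (g c) x) C X1 X2 X3 X4 X5 X6 =
          Q S C X1 X2 X3 X4 X5 X6 + L1 p * Q gx C X1 X2 X3 X4 X5 X6
          - 1 / (n - 2)\<^sup>2 *
            Q gx (\<lambda>Y1 Y2 Y3 Y4. kulkarni_nomizu gx S2 Y1 Y2 Y3 Y4
                     + (n - 2) / 2 * kulkarni_nomizu S S Y1 Y2 Y3 Y4
                     - \<kappa> * kulkarni_nomizu gx S Y1 Y2 Y3 Y4) X1 X2 X3 X4 X5 X6"
      unfolding Let_def using identity unfolding W_eq .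
    fix \<alpha> :: "'p \<Rightarrow> real"
    assume "\<forall>p \<in> U_S X \<A> g \<inter> U_C X \<A> g. \<forall>c \<in> charts_at \<A> p.
          bilin_rank (\<lambda>u v. ricci (g c) (snd c p) u v - \<alpha> p * g c (snd c p) u v) = 1"
    then have "bilin_rank (\<lambda>u v. ricci (g c) (snd c p) u v - \<alpha> p * g c (snd c p) u v) = 1"
      using p by blast
    from identity[unfolded Q_W_quasi_einstein[OF this]]
    show "let x = snd c p; R = riem (g c) x; C = weyl (g c) x; S = ricci (g c) x
          in dot (weyl_endo (g c) x) R X1 X2 X3 X4 X5 X6
               - dot (curv (g c) x) C X1 X2 X3 X4 X5 X6 =
             Q S C X1 X2 X3 X4 X5 X6 + L1 p * Q (g c x) C X1 X2 X3 X4 X5 X6"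
      unfolding Let_def by simp
  qed
qed

end
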